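(* Let $k\ge 1$, $n\ge 5$, let $\Omega\subset\mathbb{R}^2$ be open and convex, and let $A\in C^k(\Omega,\mathbb{C}^{n\times n})$. Assume that the eigenvalues of $A$ can be labeled so that, for all $\xi\in\Omega$, they are grouped into three mutually disjoint sets $$\{\lambda_1(\xi),\lambda_2(\xi)\},\quad\{\lambda_3(\xi),\lambda_4(\xi)\},\quad\{\lambda_5(\xi),\dots,\lambda_n(\xi)\}.$$ Suppose that $\xi_0,\xi_1\in\Omega$ are two distinct generic cuspidal points (GCPs) of $A$ where $\lambda_1(\xi_0)=\lambda_2(\xi_0)$ and $\lambda_3(\xi_1)=\lambda_4(\xi_1)$, and that $A(\xi)$ has distinct eigenvalues everywhere else in $\Omega$. Let $\Gamma\subset\Omega$ be a smooth Jordan curve encircling both $\xi_0$ and $\xi_1$, parametrized by $\gamma$ in such a way that both $\gamma(\cdot)$ and $A(\gamma(\cdot))$ are $1$-periodic. Let $A(\gamma(t))=V(t)\Lambda(t)V^{-1}(t)$, $t\in\mathbb{R}$, be a $C^k$ parallel-transport eigendecomposition. Then the eigenvalues of $A(\gamma(\cdot))$ can be labeled so that, for some constants $\alpha_1,\dots,\alpha_n\in\mathbb{R}$ and for all $t\in\mathbb{R}$: (i) $\lambda_1(t+1)=\lambda_2(t)$, $\lambda_2(t+1)=\lambda_1(t)$; (ii) $\lambda_3(t+1)=\lambda_4(t)$, $\lambda_4(t+1)=\lambda_3(t)$; (iii) $\lambda_j(t+1)=\lambda_j(t)$ for all $j\ge5$; (iv) $V^{-1}(t)V(t+1)=\begin{bmatrix}0&e^{i\alpha_2}\\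 e^{i\alpha_1}&0\end{bmatrix}\oplus\begin{bmatrix}0&e^{i\alpha_4}\\ e^{i\alpha_3}&0\end{bmatrix}\oplus\mathrm{diag}(e^{i\alpha_5},\dots,e^{i\alpha_n})$ (block diagonal), with $\sum_{j=1}^n\alpha_j=0\pmod{2\pi}$.
   Context: GCP for $2\times2$ functions: for $E(\xi)=\begin{bmatrix} a(\xi)&b(\xi)\\ c(\xi)&d(\xi)\end{bmatrix}$ of class $C^k$, put $\Delta(\xi)=(a(\xi)-d(\xi))^2+4b(\xi)c(\xi)$ and $F(\xi)=(\mathrm{Re}\,\Delta(\xi),\mathrm{Im}\,\Delta(\xi))$. A point $\xi_0$ is a GCP of $E$ if $F(\xi_0)=0$ and the Jacobian $DF(\xi_0)$ is invertible. GCP for $n\times n$ functions, $n>2$: a point $\xi_0\in\Omega$ where $A$ has a multiple eigenvalue is a GCP of $A$ if there is a rectangle $R\subset\Omega$ containing $\xi_0$ in its interior on which the eigenvalues of $A(\xi)$ split into two disjoint groups, one consisting of the two eigenvalues that coalesce at $\xi_0$ and the other of the remaining $n-2$, with an invertible $T\in C^k(R,\mathbb{C}^{n\times n})$ such that $T^{-1}(\xi)A(\xi)T(\xi)=\mathrm{diag}(E_1(\xi),E_2(\xi))$ on $R$, where the $2\times2$ block $E_1$ carries the first group and $E_2$ the second, and such that $\xi_0$ is a GCP of $E_1$ and the eigenvalues of $E_2(\xi)$ are simple for all $\xi\in R$. "$p$-periodic" means that $p$ is the minimal positive period. A smooth Jordan curve is a $C^1$, $1$-periodic map $\gamma:\mathbb{R}\to\mathbb{R}^2$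 that is one-to-one on $[0,1)$; its image $\Gamma$ is also called a smooth Jordan curve. $\Gamma$ encircles a point if the point lies in the bounded component of $\mathbb{R}^2\setminus\Gamma$. Parallel-transport eigendecomposition: for a matrix function $B(t)\in\mathbb{C}^{n\times n}$ with distinct eigenvalues for all $t$, a $C^k$ eigendecomposition is $B(t)=V(t)\Lambda(t)V^{-1}(t)$ with $V=[v_1,\dots,v_n]$ invertible, $\Lambda=\mathrm{diag}(\lambda_1,\dots,\lambda_n)$, and $V,\Lambda$ of class $C^k$. Put $P(t)=V^{-1}(t)\dot V(t)$. It is called here a parallel-transport eigendecomposition if for all $j$ and $t$: $\mathrm{Re}(v_j^*v_jP_{jj})=-\sum_{l\ne j}\mathrm{Re}(v_j^*v_lP_{lj})$ (equivalently, $\|v_j(t)\|$ is constant in $t$), and $\mathrm{Im}(P_{jj}(t))=0$.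
   Formalization: Added: columns of V whose eigenvalues are carried into each other over one period have equal norm (e.g. unit columns), since (iv) fails if one column is rescaled by 2; and each of the three eigenvalue groups varies continuously (upper hemicontinuously) as a set in ξ. *)

theory Defs
  imports "HOL-Analysis.Analysis" "Jordan_Normal_Form.Spectral_Radius"
begin

no_notation Finite_Cartesian_Product.vec_nth (infixl "$" 90)

text \<open>Matrices are those of \<open>Jordan_Normal_Form\<close>, with indices starting at 0; accordingly the
  eigenvalues usually called \<open>\<lambda>\<^sub>1, \<dots>, \<lambda>\<^sub>n\<close> are here labelled by \<open>0, \<dots>, n - 1\<close>.\<close>

text \<open>Class \<open>C\<^sup>k\<close> on \<open>S\<close>. The derivatives are taken within \<open>S\<close>, which is used only for sets \<open>S\<close> on
  which they are unique: open sets and closed rectangles with nonempty interior.\<close>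

primrec Ck :: "nat \<Rightarrow> 'a::real_normed_vector set \<Rightarrow> ('a \<Rightarrow> 'b::real_normed_vector) \<Rightarrow> bool" where
  "Ck 0 S f \<longleftrightarrow> continuous_on S f"
| "Ck (Suc k) S f \<longleftrightarrow> (\<forall>x\<in>S. f differentiable (at x within S)) \<and>
     (\<forall>v. Ck k S (\<lambda>x. frechet_derivative f (at x within S) v))"

definition Ck_mat ::
  "nat \<Rightarrow> nat \<Rightarrow> 'a::real_normed_vector set \<Rightarrow> ('a \<Rightarrow> complex mat) \<Rightarrow> bool" where
  "Ck_mat n k S M \<longleftrightarrow> (\<forall>x\<in>S. M x \<in> carrier_mat n n) \<and>
     (\<forall>i<n. \<forall>j<n. Ck k S (\<lambda>x. M x $$ (i,j)))"

definition minv :: "complex mat \<Rightarrow> complex mat" where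
  "minv M = the (mat_inverse M)"

definition simple_eigenvalues :: "complex mat \<Rightarrow> bool" where
  "simple_eigenvalues M \<longleftrightarrow> rsquarefree (char_poly M)"

text \<open>Labels list the eigenvalues with algebraic multiplicity.\<close>

definition eigenvalues_labelled :: "nat \<Rightarrow> complex mat \<Rightarrow> (nat \<Rightarrow> complex) \<Rightarrow> bool" where
  "eigenvalues_labelled n M l \<longleftrightarrow> char_poly M = (\<Prod>j<n. [:- l j, 1:])"

text \<open>The groups of eigenvalues are pairwise disjoint and each of them, as a set, varies
  continuously with the point. No continuity of the single labelled eigenvalues is asked for, since
  two eigenvalues that coalesce at a point need not have continuous branches around it. Without
  continuity of the groups, the grouping could change arbitrarily from point to point.
  Upper hemicontinuity suffices, because the spectrum as a whole is continuous.\<close>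

definition eigenvalue_groups ::
  "(real^2) set \<Rightarrow> (real^2 \<Rightarrow> nat \<Rightarrow> complex) \<Rightarrow> nat set set \<Rightarrow> bool" where
  "eigenvalue_groups \<Omega> lam \<G> \<longleftrightarrow>
     (\<forall>\<xi>\<in>\<Omega>. \<forall>G\<in>\<G>. \<forall>H\<in>\<G>. G \<noteq> H \<longrightarrow> lam \<xi> ` G \<inter> lam \<xi> ` H = {}) \<and>
     (\<forall>\<xi>\<in>\<Omega>. \<forall>G\<in>\<G>. \<forall>U. open U \<and> lam \<xi> ` G \<subseteq> U \<longrightarrow>
        (\<forall>\<^sub>F \<eta> in at \<xi> within \<Omega>. lam \<eta> ` G \<subseteq> U))"

definition Delta :: "complex mat \<Rightarrow> complex" where
  "Delta E = (E $$ (0,0) - E $$ (1,1))\<^sup>2 + 4 * E $$ (0,1) * E $$ (1,0)"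

definition gcp_2 :: "nat \<Rightarrow> (real^2) set \<Rightarrow> (real^2 \<Rightarrow> complex mat) \<Rightarrow> real^2 \<Rightarrow> bool" where
  "gcp_2 k S E \<xi>\<^sub>0 \<longleftrightarrow> Ck_mat 2 k S E \<and>
     (let F = (\<lambda>\<xi>. vector [Re (Delta (E \<xi>)), Im (Delta (E \<xi>))] :: real^2)
      in F \<xi>\<^sub>0 = 0 \<and> invertible (jacobian F (at \<xi>\<^sub>0)))"

text \<open>Generic cuspidal points for \<open>n > 2\<close>. The pair that coalesces at \<open>\<xi>\<^sub>0\<close> is necessarily the one
  carried by \<open>E1\<close>: the spectra of \<open>E1\<close> and \<open>E2\<close> are disjoint, and \<open>E2\<close> has simple eigenvalues.\<close>

definition gcp ::
  "nat \<Rightarrow> nat \<Rightarrow> (real^2) set \<Rightarrow> (real^2 \<Rightarrow> complex mat) \<Rightarrow> real^2 \<Rightarrow> bool" where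
  "gcp n k \<Omega> A \<xi>\<^sub>0 \<longleftrightarrow>
     \<xi>\<^sub>0 \<in> \<Omega> \<and> (\<exists>x. 2 \<le> order x (char_poly (A \<xi>\<^sub>0))) \<and>
     (\<exists>a b T E1 E2.
        cbox a b \<subseteq> \<Omega> \<and> \<xi>\<^sub>0 \<in> box a b \<and>
        Ck_mat n k (cbox a b) T \<and>
        (\<forall>\<xi>\<in>cbox a b.
           invertible_mat (T \<xi>) \<and>
           E1 \<xi> \<in> carrier_mat 2 2 \<and> E2 \<xi> \<in> carrier_mat (n - 2) (n - 2) \<and>
           minv (T \<xi>) * A \<xi> * T \<xi> = diag_block_mat [E1 \<xi>, E2 \<xi>] \<and>
           spectrum (E1 \<xi>) \<inter> spectrum (E2 \<xi>) = {} \<and>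
           simple_eigenvalues (E2 \<xi>)) \<and>
        gcp_2 k (cbox a b) E1 \<xi>\<^sub>0)"

definition minimal_period :: "real \<Rightarrow> (real \<Rightarrow> 'a) \<Rightarrow> bool" where
  "minimal_period p f \<longleftrightarrow> 0 < p \<and> (\<forall>t. f (t + p) = f t) \<and>
     (\<forall>q. 0 < q \<and> q < p \<longrightarrow> \<not> (\<forall>t. f (t + q) = f t))"

definition smooth_jordan_curve :: "(real \<Rightarrow> real^2) \<Rightarrow> bool" where
  "smooth_jordan_curve \<gamma> \<longleftrightarrow> Ck 1 UNIV \<gamma> \<and> minimal_period 1 \<gamma> \<and> inj_on \<gamma> {0..<1}"

definition mat_derivative :: "nat \<Rightarrow> (real \<Rightarrow> complex mat) \<Rightarrow> real \<Rightarrow> complex mat" where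
  "mat_derivative n V t = mat n n (\<lambda>(i,j). vector_derivative (\<lambda>s. V s $$ (i,j)) (at t))"

text \<open>\<open>v\<^sub>j\<^sup>* v\<^sub>l\<close>, i.e. conjugate linear in the \<open>j\<close>-th column.\<close>

definition col_inner :: "complex mat \<Rightarrow> nat \<Rightarrow> nat \<Rightarrow> complex" where
  "col_inner V j l = col V l \<bullet>c col V j"

definition Ck_eigendecomposition ::
  "nat \<Rightarrow> nat \<Rightarrow> (real \<Rightarrow> complex mat) \<Rightarrow> (real \<Rightarrow> complex mat) \<Rightarrow> (real \<Rightarrow> nat \<Rightarrow> complex) \<Rightarrow> bool" where
  "Ck_eigendecomposition n k B V mu \<longleftrightarrow>
     Ck_mat n k UNIV V \<and> (\<forall>j<n. Ck k UNIV (\<lambda>t. mu t j)) \<and>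
     (\<forall>t. invertible_mat (V t) \<and> B t = V t * mat_diag n (mu t) * minv (V t))"

definition parallel_transport ::
  "nat \<Rightarrow> (real \<Rightarrow> complex mat) \<Rightarrow> bool" where
  "parallel_transport n V \<longleftrightarrow>
     (\<forall>t. \<forall>j<n. let P = minv (V t) * mat_derivative n V t in
        Re (col_inner (V t) j j * P $$ (j,j)) =
          - (\<Sum>l\<in>{..<n} - {j}. Re (col_inner (V t) j l * P $$ (l,j))) \<and>
        Im (P $$ (j,j)) = 0)"

text \<open>Normalization of the eigenvectors. Parallel transport keeps the norm of each column constant
  in time, but does not relate the norms of different columns: it is preserved when the columns are
  multiplied by arbitrary nonzero constants. If the \<open>i\<close>-th eigenvalue becomes the \<open>j\<close>-th one
  after one period, then the corresponding nonzero entry of \<open>V\<^sup>-\<^sup>1(t) V(t + 1)\<close> has modulus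
  \<open>\<parallel>v\<^sub>i\<parallel> / \<parallel>v\<^sub>j\<parallel>\<close>, which is 1 exactly under the following condition. It holds in particular for unit
  eigenvectors, and for any common norm of the columns.\<close>

definition matching_norms :: "nat \<Rightarrow> (real \<Rightarrow> complex mat) \<Rightarrow> (real \<Rightarrow> nat \<Rightarrow> complex) \<Rightarrow> bool" where
  "matching_norms n V mu \<longleftrightarrow>
     (\<forall>i<n. \<forall>j<n. mu 1 i = mu 0 j \<longrightarrow> col_inner (V 0) i i = col_inner (V 0) j j)"

definition permute_cols :: "nat \<Rightarrow> (nat \<Rightarrow> nat) \<Rightarrow> complex mat \<Rightarrow> complex mat" where
  "permute_cols n p M = mat n n (\<lambda>(i,j). M $$ (i, p j))"

definition swap_block :: "real \<Rightarrow> real \<Rightarrow> complex mat" where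
  "swap_block a b = mat_of_rows_list 2 [[0, cis b], [cis a, 0]]"

end

theory Submission
  imports Defs "HOL-Complex_Analysis.Riemann_Mapping"
begin

text \<open>The squared difference of a coalescing pair of eigenvalues is a continuous function on
  \<open>\<Omega>\<close> whose only zero is the cuspidal point, where its derivative is invertible. Hence it
  winds exactly once around 0 along \<open>\<Gamma>\<close>, and its square root, the difference itself, changes
  sign: the pair is swapped. The eigenvalues that never coalesce form a covering of the simply
  connected set \<open>\<Omega>\<close> and therefore return to themselves.
  Consequently each column of \<open>V(t + 1)\<close> is a multiple of a column of \<open>V(t)\<close>. Parallel
  transport makes the logarithmic derivative of the multiplier real and its modulus constant, so the
  multiplier is a constant \<open>e\<^sup>i\<^sup>\<alpha>\<close>. Moreover \<open>det V\<close> keeps its argument, because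
  its logarithmic derivative is the trace of \<open>V\<^sup>-\<^sup>1 V'\<close>, which is real; as the two
  swaps form an even permutation, the product of the multipliers is 1.\<close>

section \<open>Continuity of groups of eigenvalues\<close>

text \<open>The labels \<open>lam\<close> are chosen point by point, so a single
  \<open>lam \<xi> j\<close> cannot be assumed continuous. Only what does not depend on the order
  inside a group is regular: the set of its values and, for a pair, the squared difference. Two
  kinds of labels therefore coexist: \<open>lam\<close> on \<Omega>, which carries the groups, and
  the smooth \<open>mu\<close> along the curve. They are matched at time 0, and connectedness of the
  real line carries the matching of the groups to all times. The block describing a cuspidal point
  lives on a small rectangle, while the curve may leave that rectangle. The squared difference is a
  global substitute for the discriminant of the block: the two agree near the cuspidal point, which
  transfers the derivative. That it does not vanish at the other cuspidal point rests on the
  simplicity of the second block: a cuspidal point has just one multiple eigenvalue, and the groups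
  are disjoint.\<close>

lemma Ck_imp_continuous_on: "Ck k S f \<Longrightarrow> continuous_on S f"
proof (cases k)
  case (Suc m)
  assume "Ck k S f"
  with Suc show ?thesis
    by (auto intro!: differentiable_imp_continuous_on simp: differentiable_on_def)
qed simp

lemma continuous_on_det:
  fixes M :: "'a::topological_space \<Rightarrow> complex mat"
  assumes "\<And>x. x \<in> S \<Longrightarrow> M x \<in> carrier_mat n n"
    and "\<And>i j. \<lbrakk>i < n; j < n\<rbrakk> \<Longrightarrow> continuous_on S (\<lambda>x. M x $$ (i,j))"
  shows "continuous_on S (\<lambda>x. det (M x))"
proof -
  have "continuous_on S (\<lambda>x. \<Sum>p | p permutes {0..<n}. signof p * (\<Prod>i = 0..<n. M x $$ (i, p i)))"
    by (intro continuous_intros assms) (auto dest: permutes_in_image)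
  then show ?thesis
    by (rule continuous_on_cong[THEN iffD1, rotated -1]) (simp_all add: det_def'[OF assms(1)])
qed

lemma continuous_on_char_poly:
  fixes M :: "'a::topological_space \<Rightarrow> complex mat"
  assumes "\<And>x. x \<in> S \<Longrightarrow> M x \<in> carrier_mat n n"
    and "\<And>i j. \<lbrakk>i < n; j < n\<rbrakk> \<Longrightarrow> continuous_on S (\<lambda>x. M x $$ (i,j))"
  shows "continuous_on S (\<lambda>x. poly (char_poly (M x)) z)"
proof -
  have "continuous_on S (\<lambda>x. det (- char_matrix (M x) z))"
  proof (rule continuous_on_det)
    show "continuous_on S (\<lambda>x. (- char_matrix (M x) z) $$ (i, j))" if "i < n" "j < n" for i j
    proof -
      have "continuous_on S (\<lambda>x. - (M x $$ (i,j) + (if i = j then - z else 0)))"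
        using that by (intro continuous_intros assms)
      then show ?thesis
        by (rule continuous_on_cong[THEN iffD1, rotated -1])
          (use that assms(1) in \<open>force simp: char_matrix_def\<close>)+
    qed
  qed (use assms(1) in auto)
  then show ?thesis
    by (rule continuous_on_cong[THEN iffD1, rotated -1]) (simp_all add: char_poly_matrix[OF assms(1)])
qed

section \<open>Algebraic multiplicities of labelled eigenvalues\<close>

lemma order_prod_linear:
  fixes l :: "nat \<Rightarrow> complex"
  shows "order x (\<Prod>j<n. [:- l j, 1:]) = card {j. j < n \<and> l j = x}"
proof (induction n)
  case (Suc n)
  have nz: "(\<Prod>j<n. [:- l j, 1:]) * [:- l n, 1:] \<noteq> 0"
    by (intro no_zero_divisors) auto
  have "order x (\<Prod>j<Suc n. [:- l j, 1:]) = card {j. j < n \<and> l j = x} + order x [:- l n, 1:]"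
    using Suc order_mult[OF nz] by simp
  also have "order x [:- l n, 1:] = (if l n = x then 1 else 0)"
    using order_linear[of "l n"] by (auto simp: order_0I)
  also have "card {j. j < n \<and> l j = x} + (if l n = x then 1 else 0) = card {j. j < Suc n \<and> l j = x}"
  proof (cases "l n = x")
    case True
    then have "{j. j < Suc n \<and> l j = x} = insert n {j. j < n \<and> l j = x}"
      by (auto simp: less_Suc_eq)
    then show ?thesis using True by simp
  next
    case False
    then have "{j. j < Suc n \<and> l j = x} = {j. j < n \<and> l j = x}"
      by (auto simp: less_Suc_eq)
    then show ?thesis using False by simp
  qed
  finally show ?case .
qed simp

text \<open>This turns coinciding labels into algebraic multiplicity, the form in which
  \<open>gcp\<close> speaks of a multiple eigenvalue.\<close>

lemma order_labelled_ge_2: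
  assumes "eigenvalues_labelled n M l" "i < n" "j < n" "i \<noteq> j" "l i = l j"
  shows "2 \<le> order (l i) (char_poly M)"
proof -
  have "card {i, j} \<le> card {m. m < n \<and> l m = l i}"
    using assms by (intro card_mono) auto
  then show ?thesis
    using assms by (simp add: eigenvalues_labelled_def order_prod_linear)
qed

lemma labelled_root_iff:
  assumes "eigenvalues_labelled n M l"
  shows "poly (char_poly M) z = 0 \<longleftrightarrow> z \<in> l ` {..<n}"
  using assms by (auto simp: eigenvalues_labelled_def poly_prod)

lemma inj_on_labelled:
  assumes "eigenvalues_labelled n M l" "simple_eigenvalues M"
  shows "inj_on l {..<n}"
proof (rule inj_onI, rule ccontr)
  fix i j assume "i \<in> {..<n}" "j \<in> {..<n}" "l i = l j" "i \<noteq> j"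
  with order_labelled_ge_2[OF assms(1)] have "2 \<le> order (l i) (char_poly M)" by simp
  moreover have "order (l i) (char_poly M) = 0 \<or> order (l i) (char_poly M) = 1"
    using assms(2) by (auto simp: simple_eigenvalues_def rsquarefree_def)
  ultimately show False by auto
qed

text \<open>The factor 2 makes the balls of radius \<open>r\<close> around the values disjoint.
  Stating it for all small \<open>r\<close> lets the bound be combined with other conditions on the
  same radius.\<close>

lemma finite_inj_on_separation:
  fixes f :: "'a \<Rightarrow> 'b::metric_space"
  assumes "finite G" "inj_on f G"
  shows "\<forall>\<^sub>F r in at_right 0. \<forall>i\<in>G. \<forall>j\<in>G. i \<noteq> j \<longrightarrow> 2 * r \<le> dist (f i) (f j)"
proof (intro eventually_ball_finite assms ballI)
  fix i j assume "i \<in> G" "j \<in> G"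
  show "\<forall>\<^sub>F r in at_right 0. i \<noteq> j \<longrightarrow> 2 * r \<le> dist (f i) (f j)"
  proof (cases "i = j")
    case False
    then have "f i \<noteq> f j" using assms(2) \<open>i \<in> G\<close> \<open>j \<in> G\<close> by (auto dest: inj_onD)
    then show ?thesis
      unfolding eventually_at_right_field by (intro exI[of _ "dist (f i) (f j) / 2"]) auto
  qed auto
qed

text \<open>Two kinds of continuity work together: that of the matrix entries yields an eigenvalue
  near each old one, and that of the groups keeps the labels in their groups.\<close>

locale spectral_groups =
  fixes n :: nat and \<Omega> :: "(real^2) set" and A :: "real^2 \<Rightarrow> complex mat"
    and lam :: "real^2 \<Rightarrow> nat \<Rightarrow> complex" and \<G> :: "nat set set"
  assumes open_dom: "open \<Omega>"
    and carrier: "\<And>\<xi>. \<xi> \<in> \<Omega> \<Longrightarrow> A \<xi> \<in> carrier_mat n n"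
    and cont: "\<And>i j. \<lbrakk>i < n; j < n\<rbrakk> \<Longrightarrow> continuous_on \<Omega> (\<lambda>\<xi>. A \<xi> $$ (i,j))"
    and labelled: "\<And>\<xi>. \<xi> \<in> \<Omega> \<Longrightarrow> eigenvalues_labelled n (A \<xi>) (lam \<xi>)"
    and groups: "eigenvalue_groups \<Omega> lam \<G>"
    and Union_groups: "\<Union>\<G> = {..<n}"
begin

lemma eventually_dom: "\<xi> \<in> \<Omega> \<Longrightarrow> \<forall>\<^sub>F \<eta> in nhds \<xi>. \<eta> \<in> \<Omega>"
  using open_dom eventually_nhds by blast

text \<open>The characteristic polynomial of \<open>A \<eta>\<close>, evaluated at the old
  eigenvalue, is a product of \<open>n\<close> differences and tends to 0. Once its modulus is below
  \<open>e ^ n\<close>, one of the factors must be smaller than \<open>e\<close>.\<close>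

lemma eventually_near_eigenvalue:
  assumes "\<xi> \<in> \<Omega>" "j < n" "0 < e"
  shows "\<forall>\<^sub>F \<eta> in nhds \<xi>. \<exists>i<n. dist (lam \<eta> i) (lam \<xi> j) < e"
proof -
  define f where "f = (\<lambda>\<eta>. poly (char_poly (A \<eta>)) (lam \<xi> j))"
  have "continuous_on \<Omega> f"
    unfolding f_def by (rule continuous_on_char_poly[OF carrier cont])
  then have "isCont f \<xi>"
    using assms(1) open_dom continuous_on_eq_continuous_at by blast
  then have "(f \<longlongrightarrow> f \<xi>) (nhds \<xi>)"
    by (simp add: isCont_def tendsto_at_iff_tendsto_nhds)
  moreover have "f \<xi> = 0"
    using labelled_root_iff[OF labelled[OF assms(1)]] assms(2) by (auto simp: f_def)
  ultimately have "\<forall>\<^sub>F \<eta> in nhds \<xi>. dist (f \<eta>) 0 < e ^ n"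
    using assms(3) by (intro tendstoD) auto
  then show ?thesis
    using eventually_dom[OF assms(1)]
  proof eventually_elim
    case (elim \<eta>)
    have f: "f \<eta> = (\<Prod>i<n. lam \<xi> j - lam \<eta> i)"
      using labelled[OF elim(2)] by (simp add: f_def eigenvalues_labelled_def poly_prod)
    show ?case
    proof (rule ccontr)
      assume "\<not> ?case"
      then have "e \<le> norm (lam \<xi> j - lam \<eta> i)" if "i < n" for i
        using that by (metis dist_norm norm_minus_commute not_less)
      then have "(\<Prod>i<n. e) \<le> (\<Prod>i<n. norm (lam \<xi> j - lam \<eta> i))"
        using assms(3) by (intro prod_mono) auto
      then show False
        using elim(1) by (simp add: f prod_norm)
    qed
  qed
qed

lemma eventually_group_subset:
  assumes "\<xi> \<in> \<Omega>" "G \<in> \<G>" "open U" "lam \<xi> ` G \<subseteq> U"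
  shows "\<forall>\<^sub>F \<eta> in nhds \<xi>. lam \<eta> ` G \<subseteq> U"
proof -
  have "\<forall>\<^sub>F \<eta> in at \<xi> within \<Omega>. lam \<eta> ` G \<subseteq> U"
    using groups[unfolded eigenvalue_groups_def, THEN conjunct2, rule_format, OF assms(1,2)] assms(3,4) by simp
  then show ?thesis
    using assms(4) at_within_open[OF assms(1) open_dom] by (simp add: eventually_nhds_conv_at)
qed

text \<open>The values of all other groups are enclosed in an open set \<open>U'\<close> disjoint
  from \<open>U\<close>. Semicontinuity of every group then yields both directions: a label outside
  \<open>G\<close> lies in another group, whose values stay in \<open>U'\<close>.\<close>

lemma group_isolated:
  assumes "\<xi> \<in> \<Omega>" "G \<in> \<G>"
  obtains U where "open U" "lam \<xi> ` G \<subseteq> U" "\<forall>\<^sub>F \<eta> in nhds \<xi>. \<forall>i<n. lam \<eta> i \<in> U \<longleftrightarrow> i \<in> G"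
proof -
  have G: "G \<subseteq> {..<n}" using assms(2) Union_groups by auto
  have fin: "finite \<G>" using Union_groups by (intro finite_UnionD) auto
  have disj: "lam \<xi> ` G \<inter> lam \<xi> ` H = {}" if "H \<in> \<G>" "H \<noteq> G" for H
    using groups[unfolded eigenvalue_groups_def, THEN conjunct1, rule_format, OF assms(1,2) that(1)] that(2) by auto
  define K where "K = (\<Union>H\<in>\<G> - {G}. lam \<xi> ` H)"
  have "finite H" if "H \<in> \<G>" for H
    using that Union_groups by (intro finite_subset[of H "{..<n}"]) auto
  then have finK: "finite K"
    unfolding K_def using fin by auto
  have finG: "finite (lam \<xi> ` G)" using G by (simp add: finite_subset)
  have GK: "lam \<xi> ` G \<inter> K = {}"
    using disj by (simp add: K_def Int_UN_distrib)
  obtain U U' where U: "open U" "compact (closure U)" "open U'" "lam \<xi> ` G \<subseteq> U" "K \<subseteq> U'" "U \<inter> U' = {}"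
    by (rule separation_normal_compact[OF finite_imp_compact[OF finG] finite_imp_closed[OF finK] GK])
  have "\<forall>\<^sub>F \<eta> in nhds \<xi>. \<forall>H\<in>\<G> - {G}. lam \<eta> ` H \<subseteq> U'"
    using fin U(3,5) by (intro eventually_ball_finite ballI eventually_group_subset[OF assms(1)]) (auto simp: K_def)
  with eventually_group_subset[OF assms U(1,4)]
  have "\<forall>\<^sub>F \<eta> in nhds \<xi>. \<forall>i<n. lam \<eta> i \<in> U \<longleftrightarrow> i \<in> G"
  proof eventually_elim
    case (elim \<eta>)
    show ?case
    proof (intro allI impI iffI)
      fix i assume "i < n" "lam \<eta> i \<in> U"
      then obtain H where "H \<in> \<G>" "i \<in> H" using Union_groups by auto
      with elim(2) \<open>lam \<eta> i \<in> U\<close> U(6) show "i \<in> G" by blast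
    qed (use elim(1) in auto)
  qed
  then show thesis by (rule that[OF U(1,4)])
qed

text \<open>Each old value attracts a new eigenvalue; being close, it lies in the isolating set, so
  its label is in \<open>G\<close>. Distinct old values are at least two radii apart, hence attract
  distinct labels, and an injective self-map of a finite set is bijective.\<close>

lemma eventually_matching:
  assumes "\<xi> \<in> \<Omega>" "G \<in> \<G>" "inj_on (lam \<xi>) G" "0 < e"
  shows "\<forall>\<^sub>F \<eta> in nhds \<xi>. \<exists>\<pi>. bij_betw \<pi> G G \<and> (\<forall>j\<in>G. dist (lam \<eta> (\<pi> j)) (lam \<xi> j) < e)"
proof -
  have G: "G \<subseteq> {..<n}" using assms(2) Union_groups by auto
  then have finG: "finite G" by (rule finite_subset) auto
  obtain U where U: "open U" "lam \<xi> ` G \<subseteq> U" "\<forall>\<^sub>F \<eta> in nhds \<xi>. \<forall>i<n. lam \<eta> i \<in> U \<longleftrightarrow> i \<in> G"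
    using group_isolated[OF assms(1,2)] .
  have "\<forall>\<^sub>F r in at_right 0. ball (lam \<xi> j) r \<subseteq> U" if "j \<in> G" for j
  proof -
    have "lam \<xi> j \<in> U" using U(2) that by auto
    then obtain d where "d > 0" "ball (lam \<xi> j) d \<subseteq> U"
      by (rule openE[OF U(1)])
    then show ?thesis
      unfolding eventually_at_right_field by (intro exI[of _ d]) (auto simp: subset_eq)
  qed
  then have "\<forall>\<^sub>F r in at_right 0. \<forall>j\<in>G. ball (lam \<xi> j) r \<subseteq> U"
    by (intro eventually_ball_finite finG ballI)
  then have "\<forall>\<^sub>F r in at_right 0. r > 0 \<and> (\<forall>j\<in>G. ball (lam \<xi> j) r \<subseteq> U) \<and>
      (\<forall>i\<in>G. \<forall>j\<in>G. i \<noteq> j \<longrightarrow> 2 * r \<le> dist (lam \<xi> i) (lam \<xi> j))"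
    by (intro eventually_conj eventually_at_right_less finite_inj_on_separation finG assms(3))
  then obtain r0 where r0: "r0 > 0" "\<And>j. j \<in> G \<Longrightarrow> ball (lam \<xi> j) r0 \<subseteq> U"
    "\<And>i j. \<lbrakk>i \<in> G; j \<in> G; i \<noteq> j\<rbrakk> \<Longrightarrow> 2 * r0 \<le> dist (lam \<xi> i) (lam \<xi> j)"
    using eventually_happens'[OF trivial_limit_at_right_real[of 0]] by blast
  \<comment> \<open>The bound \<open>r0\<close> keeps the balls inside \<open>U\<close> and
    disjoint; the bound \<open>e\<close> gives the required closeness.\<close>
  define r where "r = min r0 e"
  have r: "0 < r" "r \<le> r0" "r \<le> e" using r0 assms(4) by (auto simp: r_def)
  have "\<forall>\<^sub>F \<eta> in nhds \<xi>. \<forall>j\<in>G. \<exists>i<n. dist (lam \<eta> i) (lam \<xi> j) < r"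
    using G r(1) assms(1) by (intro eventually_ball_finite finG ballI eventually_near_eigenvalue) auto
  with U(3) show ?thesis
  proof eventually_elim
    case (elim \<eta>)
    from bchoice[OF elim(2)] obtain \<pi>
      where \<pi>: "\<And>j. j \<in> G \<Longrightarrow> \<pi> j < n" "\<And>j. j \<in> G \<Longrightarrow> dist (lam \<eta> (\<pi> j)) (lam \<xi> j) < r"
      by blast
    have "\<pi> ` G \<subseteq> G"
    proof
      fix x assume "x \<in> \<pi> ` G"
      then obtain j where j: "j \<in> G" "x = \<pi> j" by auto
      then have "lam \<eta> x \<in> ball (lam \<xi> j) r0"
        using \<pi>(2) r(2) by (force simp: dist_commute)
      then show "x \<in> G" using elim(1) \<pi>(1)[OF j(1)] j r0(2)[OF j(1)] by auto
    qed
    moreover have "inj_on \<pi> G"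
    proof (rule inj_onI, rule ccontr)
      fix i j assume ij: "i \<in> G" "j \<in> G" "\<pi> i = \<pi> j" "i \<noteq> j"
      have "dist (lam \<xi> i) (lam \<xi> j) \<le> dist (lam \<eta> (\<pi> i)) (lam \<xi> i) + dist (lam \<eta> (\<pi> j)) (lam \<xi> j)"
        using dist_triangle3[of "lam \<xi> i" "lam \<xi> j" "lam \<eta> (\<pi> i)"] ij(3) by simp
      also have "\<dots> < 2 * r" using \<pi>(2)[OF ij(1)] \<pi>(2)[OF ij(2)] by simp
      finally show False using r0(3)[OF ij(1,2,4)] r(2) by simp
    qed
    ultimately have "bij_betw \<pi> G G"
      using endo_inj_surj[OF finG] by (simp add: bij_betw_def)
    then show ?case using \<pi>(2) r(3) by (meson order_less_le_trans)
  qed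
qed

text \<open>The expression is symmetric in \<open>a\<close> and \<open>b\<close>, so the unknown
  order of the nearby pair does no harm. Where the two values coincide no matching is available, but
  both nearby values are then close to the same number.\<close>

lemma continuous_on_diff_squared:
  assumes "{a, b} \<in> \<G>"
  shows "continuous_on \<Omega> (\<lambda>\<xi>. (lam \<xi> a - lam \<xi> b)\<^sup>2)"
proof -
  have "isCont (\<lambda>\<xi>. (lam \<xi> a - lam \<xi> b)\<^sup>2) \<xi>" if \<xi>: "\<xi> \<in> \<Omega>" for \<xi>
  proof -
    have near: "\<forall>\<^sub>F \<eta> in nhds \<xi>. \<exists>x y. dist x (lam \<xi> a) < d \<and> dist y (lam \<xi> b) < d \<and>
        (x - y)\<^sup>2 = (lam \<eta> a - lam \<eta> b)\<^sup>2" if d: "0 < d" for d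
    proof (cases "lam \<xi> a = lam \<xi> b")
      case True
      then have "\<forall>\<^sub>F \<eta> in nhds \<xi>. lam \<eta> ` {a, b} \<subseteq> ball (lam \<xi> a) d"
        using d by (intro eventually_group_subset \<xi> assms) auto
      then show ?thesis
        by eventually_elim (use True in \<open>auto simp: dist_commute\<close>)
    next
      case False
      then have "inj_on (lam \<xi>) {a, b}" by auto
      from eventually_matching[OF \<xi> assms this d] show ?thesis
      proof eventually_elim
        case (elim \<eta>)
        then obtain \<pi> where \<pi>: "bij_betw \<pi> {a, b} {a, b}" "\<forall>j\<in>{a, b}. dist (lam \<eta> (\<pi> j)) (lam \<xi> j) < d"
          by blast
        have "a \<noteq> b" using False by auto
        then have "\<pi> a = a \<and> \<pi> b = b \<or> \<pi> a = b \<and> \<pi> b = a"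
          using \<pi>(1) by (auto simp: bij_betw_def doubleton_eq_iff)
        then have "(lam \<eta> (\<pi> a) - lam \<eta> (\<pi> b))\<^sup>2 = (lam \<eta> a - lam \<eta> b)\<^sup>2"
          by (auto simp: power2_commute)
        with \<pi>(2) show ?case by blast
      qed
    qed
    have "\<forall>\<^sub>F \<eta> in nhds \<xi>. dist ((lam \<eta> a - lam \<eta> b)\<^sup>2) ((lam \<xi> a - lam \<xi> b)\<^sup>2) < e" if e: "0 < e" for e
    proof -
      have "isCont (\<lambda>p::complex \<times> complex. (fst p - snd p)\<^sup>2) (lam \<xi> a, lam \<xi> b)"
        by (intro continuous_intros)
      then obtain d where d: "d > 0" "\<And>p. dist p (lam \<xi> a, lam \<xi> b) < d \<Longrightarrow>
          dist ((fst p - snd p)\<^sup>2) ((lam \<xi> a - lam \<xi> b)\<^sup>2) < e"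
        using e unfolding continuous_at_eps_delta by (metis fst_conv snd_conv)
      have "d / 2 > 0" using d(1) by simp
      from near[OF this] show ?thesis
      proof eventually_elim
        case (elim \<eta>)
        then obtain x y where xy: "dist x (lam \<xi> a) < d / 2" "dist y (lam \<xi> b) < d / 2"
          "(x - y)\<^sup>2 = (lam \<eta> a - lam \<eta> b)\<^sup>2" by blast
        have "dist (x, y) (lam \<xi> a, lam \<xi> b) < d"
          using sqrt_sum_squares_le_sum[of "dist x (lam \<xi> a)" "dist y (lam \<xi> b)"] xy(1,2)
          by (simp add: dist_Pair_Pair)
        from d(2)[OF this] xy(3) show ?case by simp
      qed
    qed
    then show ?thesis
      unfolding isCont_def by (intro tendsto_at_iff_tendsto_nhds[THEN iffD2] tendstoI)
  qed
  then show ?thesis by (simp add: continuous_at_imp_continuous_on)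
qed

text \<open>The total space is the graph of the group over \<Omega>. Over a small neighbourhood
  \<open>N\<close> of a point, disjoint balls around the values at that point cut the graph into
  sheets. The matching bijection puts exactly one value into each ball, so every sheet projects
  homeomorphically onto \<open>N\<close>.\<close>

lemma covering_space_group:
  assumes G: "G \<in> \<G>" and inj: "\<And>\<xi>. \<xi> \<in> \<Omega> \<Longrightarrow> inj_on (lam \<xi>) G" and "G \<noteq> {}"
  shows "covering_space (SIGMA \<xi>:\<Omega>. lam \<xi> ` G) fst \<Omega>" (is "covering_space ?C _ _")
proof
  show "continuous_on ?C fst" by (intro continuous_intros)
  show "fst ` ?C = \<Omega>" using \<open>G \<noteq> {}\<close> by force
  fix \<xi> assume \<xi>: "\<xi> \<in> \<Omega>"
  have finG: "finite G" using G Union_groups by (intro finite_subset[of G "{..<n}"]) auto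
  have "\<forall>\<^sub>F r in at_right 0. r > 0 \<and> (\<forall>i\<in>G. \<forall>j\<in>G. i \<noteq> j \<longrightarrow> 2 * r \<le> dist (lam \<xi> i) (lam \<xi> j))"
    by (intro eventually_conj eventually_at_right_less finite_inj_on_separation finG inj \<xi>)
  then obtain r where r: "r > 0" "\<And>i j. \<lbrakk>i \<in> G; j \<in> G; i \<noteq> j\<rbrakk> \<Longrightarrow> 2 * r \<le> dist (lam \<xi> i) (lam \<xi> j)"
    using eventually_happens'[OF trivial_limit_at_right_real[of 0]] by blast
  have disj: "i = j" if "i \<in> G" "j \<in> G" "z \<in> ball (lam \<xi> i) r" "z \<in> ball (lam \<xi> j) r" for i j z
  proof (rule ccontr)
    assume "i \<noteq> j"
    with r(2)[OF that(1,2)] dist_triangle2[of "lam \<xi> i" "lam \<xi> j" z] that(3,4)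
    show False by simp
  qed
  have "\<forall>\<^sub>F \<eta> in nhds \<xi>. \<eta> \<in> \<Omega> \<and> (\<exists>\<pi>. bij_betw \<pi> G G \<and> (\<forall>j\<in>G. dist (lam \<eta> (\<pi> j)) (lam \<xi> j) < r))"
    by (intro eventually_conj eventually_dom eventually_matching \<xi> G inj r(1))
  then obtain N where N: "open N" "\<xi> \<in> N" "\<And>\<eta>. \<eta> \<in> N \<Longrightarrow> \<eta> \<in> \<Omega>"
    "\<And>\<eta>. \<eta> \<in> N \<Longrightarrow> \<exists>\<pi>. bij_betw \<pi> G G \<and> (\<forall>j\<in>G. dist (lam \<eta> (\<pi> j)) (lam \<xi> j) < r)"
    unfolding eventually_nhds by blast
  define slice where "slice = (\<lambda>j. ?C \<inter> (N \<times> ball (lam \<xi> j) r))"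
  have ex1: "\<exists>!z. z \<in> lam \<eta> ` G \<and> z \<in> ball (lam \<xi> j) r" if \<eta>: "\<eta> \<in> N" and j: "j \<in> G" for \<eta> j
  proof -
    obtain \<pi> where \<pi>: "bij_betw \<pi> G G" "\<And>j. j \<in> G \<Longrightarrow> dist (lam \<eta> (\<pi> j)) (lam \<xi> j) < r"
      using N(4)[OF \<eta>] by blast
    show ?thesis
    proof (rule ex1I[of _ "lam \<eta> (\<pi> j)"])
      show "lam \<eta> (\<pi> j) \<in> lam \<eta> ` G \<and> lam \<eta> (\<pi> j) \<in> ball (lam \<xi> j) r"
        using \<pi>(2)[OF j] bij_betwE[OF \<pi>(1)] j by (simp add: dist_commute)
    next
      fix z assume z: "z \<in> lam \<eta> ` G \<and> z \<in> ball (lam \<xi> j) r"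
      then obtain i where i: "i \<in> G" "z = lam \<eta> (\<pi> i)"
        using bij_betw_imp_surj_on[OF \<pi>(1)] by (metis (no_types, lifting) imageE)
      have "z \<in> ball (lam \<xi> i) r" using \<pi>(2)[OF i(1)] i(2) by (simp add: dist_commute)
      with z i j disj show "z = lam \<eta> (\<pi> j)" by blast
    qed
  qed
  show "\<exists>T. \<xi> \<in> T \<and> openin (top_of_set \<Omega>) T \<and> (\<exists>v. \<Union>v = ?C \<inter> fst -` T \<and>
      (\<forall>u\<in>v. openin (top_of_set ?C) u) \<and> pairwise disjnt v \<and> (\<forall>u\<in>v. \<exists>q. homeomorphism u T fst q))"
  proof (intro exI[of _ N] exI[of _ "slice ` G"] conjI ballI)
    show "openin (top_of_set \<Omega>) N" using N(1,3) by (intro open_openin_trans open_dom) auto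
    show "\<Union> (slice ` G) = ?C \<inter> fst -` N"
    proof (intro equalityI subsetI)
      fix p assume p: "p \<in> ?C \<inter> fst -` N"
      then obtain \<eta> i where \<eta>: "p = (\<eta>, lam \<eta> i)" "i \<in> G" "\<eta> \<in> N" by auto
      from N(4)[OF \<eta>(3)] obtain \<pi> where
        \<pi>: "bij_betw \<pi> G G" "\<And>j. j \<in> G \<Longrightarrow> dist (lam \<eta> (\<pi> j)) (lam \<xi> j) < r" by blast
      obtain j where j: "j \<in> G" "i = \<pi> j" using \<pi>(1) \<eta>(2) by (auto simp: bij_betw_def)
      then have "p \<in> slice j"
        using p \<eta> \<pi>(2)[OF j(1)] by (simp add: slice_def dist_commute)
      with j(1) show "p \<in> \<Union> (slice ` G)" by blast
    qed (auto simp: slice_def)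
    show "openin (top_of_set ?C) u" if "u \<in> slice ` G" for u
      using that N(1) by (auto simp: slice_def intro!: openin_open_Int open_Times)
    show "pairwise disjnt (slice ` G)"
      unfolding pairwise_def disjnt_def slice_def using disj by blast
    show "\<exists>q. homeomorphism u N fst q" if "u \<in> slice ` G" for u
    proof -
      from that obtain j where j: "j \<in> G" "u = slice j" by blast
      define s where "s = (\<lambda>\<eta>. THE z. z \<in> lam \<eta> ` G \<and> z \<in> ball (lam \<xi> j) r)"
      have s: "s \<eta> \<in> lam \<eta> ` G" "s \<eta> \<in> ball (lam \<xi> j) r" if "\<eta> \<in> N" for \<eta>
        using theI'[OF ex1[OF that j(1)]] by (simp_all add: s_def)
      have s_eq: "s \<eta> = z" if "\<eta> \<in> N" "z \<in> lam \<eta> ` G" "z \<in> ball (lam \<xi> j) r" for \<eta> z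
        using ex1[OF that(1) j(1)] s[OF that(1)] that by blast
      have "isCont s \<eta>" if \<eta>: "\<eta> \<in> N" for \<eta>
      proof -
        have "\<forall>\<^sub>F \<zeta> in nhds \<eta>. dist (s \<zeta>) (s \<eta>) < e" if e: "0 < e" for e
        proof -
          \<comment> \<open>A value of the group within this distance of \<open>s \<eta>\<close>
            stays in the ball defining the sheet; by uniqueness it is the new value of the
            section.\<close>
          define d where "d = min e (r - dist (lam \<xi> j) (s \<eta>))"
          have d: "d > 0" "d \<le> e" "d \<le> r - dist (lam \<xi> j) (s \<eta>)" using e s(2)[OF \<eta>] by (auto simp: d_def)
          obtain i where i: "i \<in> G" "s \<eta> = lam \<eta> i" using s(1)[OF \<eta>] by blast
          from eventually_matching[OF N(3)[OF \<eta>] G inj[OF N(3)[OF \<eta>]] d(1)]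
          have "\<forall>\<^sub>F \<zeta> in nhds \<eta>. \<exists>z\<in>lam \<zeta> ` G. dist z (s \<eta>) < d"
            by eventually_elim (use i in \<open>force dest: bij_betwE\<close>)
          moreover have "\<forall>\<^sub>F \<zeta> in nhds \<eta>. \<zeta> \<in> N" using N(1) \<eta> eventually_nhds by blast
          ultimately show ?thesis
          proof eventually_elim
            case (elim \<zeta>)
            then obtain z where z: "z \<in> lam \<zeta> ` G" "dist z (s \<eta>) < d" by blast
            have "z \<in> ball (lam \<xi> j) r"
              using dist_triangle[of "lam \<xi> j" z "s \<eta>"] z(2) d(3) by (simp add: dist_commute)
            then have "s \<zeta> = z" using s_eq elim(2) z(1) by blast
            then show ?case using z(2) d(2) by simp
          qed
        qed
        then show ?thesis
          unfolding isCont_def by (intro tendsto_at_iff_tendsto_nhds[THEN iffD2] tendstoI)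
      qed
      then have conts: "continuous_on N s" by (simp add: continuous_at_imp_continuous_on)
      have "homeomorphism u N fst (\<lambda>\<eta>. (\<eta>, s \<eta>))"
      proof
        show "continuous_on u fst" by (intro continuous_intros)
        show "continuous_on N (\<lambda>\<eta>. (\<eta>, s \<eta>))" by (intro continuous_intros conts)
        show "fst ` u \<subseteq> N" using j by (auto simp: slice_def)
        show "(\<lambda>\<eta>. (\<eta>, s \<eta>)) ` N \<subseteq> u" using s N(3) j by (auto simp: slice_def)
        show "(fst p, s (fst p)) = p" if "p \<in> u" for p
          using that s_eq[of "fst p" "snd p"] j by (auto simp: slice_def)
      qed auto
      then show ?thesis by blast
    qed
  qed (rule N(2))
qed

text \<open>The selection is the second component of a lift of the identity map to the covering by
  the graph of the group. The lift exists because a convex set is simply connected and locally path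
  connected.\<close>

lemma continuous_selection:
  assumes "G \<in> \<G>" "\<And>\<xi>. \<xi> \<in> \<Omega> \<Longrightarrow> inj_on (lam \<xi>) G" "convex \<Omega>" "\<xi> \<in> \<Omega>" "j \<in> G"
  obtains g where "continuous_on \<Omega> g" "g \<xi> = lam \<xi> j" "\<And>\<eta>. \<eta> \<in> \<Omega> \<Longrightarrow> g \<eta> \<in> lam \<eta> ` G"
proof -
  let ?C = "SIGMA \<xi>:\<Omega>. lam \<xi> ` G"
  have "G \<noteq> {}" using assms(5) by auto
  have "simply_connected \<Omega>" "locally path_connected \<Omega>"
    using assms(3) by (simp_all add: convex_imp_simply_connected convex_imp_locally_path_connected)
  then obtain h where h: "continuous_on \<Omega> h" "h \<in> \<Omega> \<rightarrow> ?C" "h \<xi> = (\<xi>, lam \<xi> j)" "\<And>\<eta>. \<eta> \<in> \<Omega> \<Longrightarrow> fst (h \<eta>) = \<eta>"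
    using covering_space_lift_strong[OF covering_space_group[OF assms(1,2) \<open>G \<noteq> {}\<close>],
        of "(\<xi>, lam \<xi> j)" \<xi> \<Omega> "\<lambda>\<eta>. \<eta>"] assms(4,5) by auto
  show thesis
  proof (rule that[of "snd \<circ> h"])
    show "continuous_on \<Omega> (snd \<circ> h)"
      unfolding o_def by (intro continuous_on_snd h(1))
    show "(snd \<circ> h) \<eta> \<in> lam \<eta> ` G" if "\<eta> \<in> \<Omega>" for \<eta>
      using h(2,4) that by (force simp: Pi_iff)
  qed (simp add: h(3))
qed

end

section \<open>The discriminant at a generic cuspidal point\<close>

lemma minv_inverts:
  assumes "M \<in> carrier_mat n n" "invertible_mat M"
  shows "minv M \<in> carrier_mat n n" "M * minv M = 1\<^sub>m n" "minv M * M = 1\<^sub>m n"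
proof -
  obtain B where B: "M * B = 1\<^sub>m n" "B * M = 1\<^sub>m (dim_row B)"
    using assms by (auto simp: invertible_mat_def inverts_mat_def)
  have "dim_row B = n" "dim_col B = n"
    using arg_cong[OF B(1), of dim_col] arg_cong[OF B(2), of dim_col] assms(1) by auto
  \<comment> \<open>The failure criterion of \<open>mat_inverse\<close> is phrased with the units of
    the matrix ring, so the inverse \<open>B\<close> first serves as a witness there.\<close>
  with B have "M \<in> Units (ring_mat TYPE(complex) n ())"
    using assms(1) by (auto simp: Units_def ring_mat_def)
  then have "mat_inverse M \<noteq> None"
    using mat_inverse(1)[OF assms(1), where b = "()"] by blast
  then have "mat_inverse M = Some (minv M)" by (auto simp: minv_def)
  from mat_inverse(2)[OF assms(1) this]
  show "minv M \<in> carrier_mat n n" "M * minv M = 1\<^sub>m n" "minv M * M = 1\<^sub>m n" by auto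
qed

section \<open>Characteristic polynomials of block diagonal and two by two matrices\<close>

lemma char_poly_diag_block_mat_pair:
  fixes B D :: "complex mat"
  assumes "B \<in> carrier_mat n n" "D \<in> carrier_mat m m"
  shows "char_poly (diag_block_mat [B, D]) = char_poly B * char_poly D"
proof -
  have block: "diag_block_mat [B, D] = four_block_mat B (0\<^sub>m n m) (0\<^sub>m m n) D"
    using assms by (simp only: diag_block_mat.simps(2)[of B "[D]"] diag_block_mat_singleton Let_def) auto
  \<comment> \<open>\<open>char_poly_0_block\<close> asks for characteristic polynomials that split
    into linear factors, as they do over the complex numbers.\<close>
  have "\<exists>es. char_poly B = (\<Prod>a\<leftarrow>es. [:- a, 1:])" "\<exists>es. char_poly D = (\<Prod>a\<leftarrow>es. [:- a, 1:])"
    using char_poly_factorized[OF assms(1)] char_poly_factorized[OF assms(2)] by blast+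
  then show ?thesis
    by (rule char_poly_0_block[OF block _ _ assms(1) zero_carrier_mat assms(2)])
qed

lemma det_mat_2:
  fixes E :: "'a::comm_ring_1 mat"
  assumes "E \<in> carrier_mat 2 2"
  shows "det E = E $$ (0,0) * E $$ (1,1) - E $$ (0,1) * E $$ (1,0)"
proof -
  have "det E = (\<Sum>i<2. E $$ (i,0) * cofactor E i 0)"
    using laplace_expansion_column[OF assms, of 0] by simp
  also have "\<dots> = E $$ (0,0) * cofactor E 0 0 + E $$ (1,0) * cofactor E 1 0"
    by (simp add: numeral_2_eq_2)
  finally have "det E = E $$ (0,0) * cofactor E 0 0 + E $$ (1,0) * cofactor E 1 0" .
  moreover have "cofactor E 0 0 = E $$ (1,1)" "cofactor E 1 0 = - E $$ (0,1)"
    using assms by (simp_all add: cofactor_def det_single mat_delete_def)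
  ultimately show ?thesis by (simp add: algebra_simps)
qed

text \<open>Completing the square shows that \<open>Delta\<close> is the discriminant of the
  characteristic polynomial. The form without a square root avoids a choice of branch.\<close>

lemma char_poly_root_iff_Delta:
  assumes "E \<in> carrier_mat 2 2"
  shows "poly (char_poly E) z = 0 \<longleftrightarrow> (2 * z - (E $$ (0,0) + E $$ (1,1)))\<^sup>2 = Delta E"
proof -
  have "poly (char_poly E) z = det (- char_matrix E z)"
    by (rule char_poly_matrix[OF assms])
  also have "\<dots> = (z - E $$ (0,0)) * (z - E $$ (1,1)) - E $$ (0,1) * E $$ (1,0)"
    using assms by (subst det_mat_2) (auto simp: char_matrix_def)
  finally have eq: "poly (char_poly E) z = (z - E $$ (0,0)) * (z - E $$ (1,1)) - E $$ (0,1) * E $$ (1,0)" .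
  have "4 * poly (char_poly E) z = (2 * z - (E $$ (0,0) + E $$ (1,1)))\<^sup>2 - Delta E"
    unfolding eq Delta_def by (simp add: power2_eq_square algebra_simps)
  then show ?thesis by auto
qed

text \<open>The Jacobian in \<open>gcp_2\<close> belongs to \<open>Delta\<close> followed by the
  linear map \<phi> from the complex numbers to the plane. Its matrix acts as \<phi> after
  \<open>L\<close>, so its invertibility makes \<open>L\<close> injective. Differentiability within
  the closed rectangle is ordinary differentiability at \<zeta>, an interior point.\<close>

lemma gcp_2_derivative:
  assumes "gcp_2 k (cbox a b) E \<zeta>" "1 \<le> k" "\<zeta> \<in> box a b"
  obtains L where "((\<lambda>\<xi>. Delta (E \<xi>)) has_derivative L) (at \<zeta>)" "inj L"
proof -
  define \<phi> :: "complex \<Rightarrow> real^2" where "\<phi> = (\<lambda>z. vector [Re z, Im z])"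
  define \<delta> where "\<delta> = (\<lambda>\<xi>. Delta (E \<xi>))"
  have "(\<lambda>\<xi>. E \<xi> $$ (i,j)) differentiable (at \<zeta>)" if "i < 2" "j < 2" for i j
  proof -
    have "Ck k (cbox a b) (\<lambda>\<xi>. E \<xi> $$ (i,j))"
      using assms(1) that by (auto simp: gcp_2_def Ck_mat_def)
    moreover obtain m where "k = Suc m" using assms(2) by (cases k) auto
    ultimately have "(\<lambda>\<xi>. E \<xi> $$ (i,j)) differentiable (at \<zeta> within cbox a b)"
      using assms(3) box_subset_cbox by auto
    then show ?thesis
      using at_within_interior[of \<zeta> "cbox a b"] assms(3) by (simp add: interior_cbox)
  qed
  then have "\<delta> differentiable (at \<zeta>)"
    unfolding \<delta>_def Delta_def
    by (intro differentiable_add differentiable_mult differentiable_power differentiable_diff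
        differentiable_const) auto
  then obtain L where L: "(\<delta> has_derivative L) (at \<zeta>)" by (auto simp: differentiable_def)
  have "linear \<phi>"
    by (rule linearI) (simp_all add: \<phi>_def Finite_Cartesian_Product.vec_eq_iff forall_2 vector_2)
  then have "bounded_linear \<phi>" by (simp add: linear_conv_bounded_linear)
  from bounded_linear.has_derivative[OF this L]
  have F: "((\<lambda>\<xi>. \<phi> (\<delta> \<xi>)) has_derivative (\<lambda>h. \<phi> (L h))) (at \<zeta>)" .
  have "invertible (jacobian (\<lambda>\<xi>. \<phi> (\<delta> \<xi>)) (at \<zeta>))"
    using assms(1) by (simp add: gcp_2_def \<phi>_def \<delta>_def Let_def)
  then have "inj ((*v) (jacobian (\<lambda>\<xi>. \<phi> (\<delta> \<xi>)) (at \<zeta>)))"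
    using matrix_left_invertible_injective unfolding invertible_def by blast
  moreover have "(*v) (jacobian (\<lambda>\<xi>. \<phi> (\<delta> \<xi>)) (at \<zeta>)) = (\<lambda>h. \<phi> (L h))"
    using frechet_derivative_at[OF F] matrix_vector_mul(2)[OF has_derivative_linear[OF F]]
    by (simp add: jacobian_def)
  ultimately have "inj L" by (auto simp: inj_on_def)
  with L that show thesis by (simp add: \<delta>_def)
qed

text \<open>The block form is traded for statements about eigenvalues of \<open>A\<close> alone:
  \<tau> and \<delta> are the trace and the discriminant of \<open>E1\<close>, and \<open>N\<close>
  is the open rectangle. The similarity factorizes the characteristic polynomial. Since
  \<open>E2\<close> is simple, a multiple eigenvalue at \<zeta> is a root of the factor of
  \<open>E1\<close>, which has only one root there because \<delta> vanishes.\<close>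

lemma gcp_local_discriminant:
  assumes "gcp n k \<Omega> A \<zeta>" "1 \<le> k" "2 \<le> n" "\<And>\<xi>. \<xi> \<in> \<Omega> \<Longrightarrow> A \<xi> \<in> carrier_mat n n"
  obtains N \<tau> \<delta> L where "open N" "\<zeta> \<in> N" "continuous_on N \<tau>" "(\<delta> has_derivative L) (at \<zeta>)"
    "inj L" "\<delta> \<zeta> = 0"
    "\<forall>\<xi>\<in>N. \<forall>s. s\<^sup>2 = \<delta> \<xi> \<longrightarrow> poly (char_poly (A \<xi>)) ((\<tau> \<xi> + s) / 2) = 0"
    "\<forall>x. 2 \<le> order x (char_poly (A \<zeta>)) \<longrightarrow> x = \<tau> \<zeta> / 2"
proof -
  obtain a b T E1 E2 where R: "cbox a b \<subseteq> \<Omega>" "\<zeta> \<in> box a b" "Ck_mat n k (cbox a b) T"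
    and blocks: "\<And>\<xi>. \<xi> \<in> cbox a b \<Longrightarrow> invertible_mat (T \<xi>) \<and>
           E1 \<xi> \<in> carrier_mat 2 2 \<and> E2 \<xi> \<in> carrier_mat (n - 2) (n - 2) \<and>
           minv (T \<xi>) * A \<xi> * T \<xi> = diag_block_mat [E1 \<xi>, E2 \<xi>] \<and>
           spectrum (E1 \<xi>) \<inter> spectrum (E2 \<xi>) = {} \<and> simple_eigenvalues (E2 \<xi>)"
    and gcp2: "gcp_2 k (cbox a b) E1 \<zeta>"
    using assms(1) unfolding gcp_def by blast
  define \<tau> where "\<tau> = (\<lambda>\<xi>. E1 \<xi> $$ (0,0) + E1 \<xi> $$ (1,1))"
  define \<delta> where "\<delta> = (\<lambda>\<xi>. Delta (E1 \<xi>))"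
  have cp: "char_poly (A \<xi>) = char_poly (E1 \<xi>) * char_poly (E2 \<xi>)" if \<xi>: "\<xi> \<in> cbox a b" for \<xi>
  proof -
    have A: "A \<xi> \<in> carrier_mat n n" using assms(4) R(1) \<xi> by auto
    have T: "T \<xi> \<in> carrier_mat n n" using R(3) \<xi> by (auto simp: Ck_mat_def)
    note inv = minv_inverts[OF T conjunct1[OF blocks[OF \<xi>]]]
    have "minv (T \<xi>) * A \<xi> * T \<xi> \<in> carrier_mat n n" using A T inv(1) by simp
    then have "similar_mat_wit (diag_block_mat [E1 \<xi>, E2 \<xi>]) (A \<xi>) (minv (T \<xi>)) (T \<xi>)"
      using A T inv blocks[OF \<xi>] by (intro similar_mat_witI[of _ _ n]) metis+
    then have "similar_mat (diag_block_mat [E1 \<xi>, E2 \<xi>]) (A \<xi>)"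
      unfolding similar_mat_def by blast
    then have "char_poly (diag_block_mat [E1 \<xi>, E2 \<xi>]) = char_poly (A \<xi>)"
      by (rule char_poly_similar)
    then show ?thesis
      using char_poly_diag_block_mat_pair[of "E1 \<xi>" 2 "E2 \<xi>" "n - 2"] blocks[OF \<xi>] by simp
  qed
  have "box a b \<subseteq> cbox a b" by (rule box_subset_cbox)
  then have \<zeta>: "\<zeta> \<in> cbox a b" using R(2) by auto
  obtain L where L: "(\<delta> has_derivative L) (at \<zeta>)" "inj L"
    using gcp_2_derivative[OF gcp2 assms(2) R(2)] unfolding \<delta>_def .
  have \<delta>0: "\<delta> \<zeta> = 0"
    using gcp2 by (simp add: gcp_2_def \<delta>_def Let_def Finite_Cartesian_Product.vec_eq_iff forall_2 vector_2 complex_eq_iff)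
  show thesis
  proof (rule that[of "box a b" \<tau> \<delta> L])
    have "continuous_on (cbox a b) \<tau>"
      using gcp2 unfolding \<tau>_def gcp_2_def Ck_mat_def
      by (intro continuous_intros Ck_imp_continuous_on[where k = k]) auto
    then show "continuous_on (box a b) \<tau>"
      using box_subset_cbox continuous_on_subset by blast
    show "\<forall>\<xi>\<in>box a b. \<forall>s. s\<^sup>2 = \<delta> \<xi> \<longrightarrow> poly (char_poly (A \<xi>)) ((\<tau> \<xi> + s) / 2) = 0"
    proof (intro ballI allI impI)
      fix \<xi> s assume that: "\<xi> \<in> box a b" "s\<^sup>2 = \<delta> \<xi>"
      have \<xi>: "\<xi> \<in> cbox a b" using that(1) box_subset_cbox by blast
      then have E1: "E1 \<xi> \<in> carrier_mat 2 2" using blocks by blast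
      have "2 * ((\<tau> \<xi> + s) / 2) - \<tau> \<xi> = s" by (simp add: add_divide_distrib)
      with that(2) have "(2 * ((\<tau> \<xi> + s) / 2) - \<tau> \<xi>)\<^sup>2 = \<delta> \<xi>" by (simp only:)
      then have "poly (char_poly (E1 \<xi>)) ((\<tau> \<xi> + s) / 2) = 0"
        unfolding char_poly_root_iff_Delta[OF E1] unfolding \<tau>_def \<delta>_def .
      then show "poly (char_poly (A \<xi>)) ((\<tau> \<xi> + s) / 2) = 0" by (simp add: cp[OF \<xi>])
    qed
    show "\<forall>x. 2 \<le> order x (char_poly (A \<zeta>)) \<longrightarrow> x = \<tau> \<zeta> / 2"
    proof (intro allI impI)
      fix x assume x: "2 \<le> order x (char_poly (A \<zeta>))"
      have "char_poly (A \<zeta>) \<noteq> 0"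
        using degree_monic_char_poly[OF assms(4)[of \<zeta>]] R(1) \<zeta> by auto
      then have "order x (char_poly (A \<zeta>)) = order x (char_poly (E1 \<zeta>)) + order x (char_poly (E2 \<zeta>))"
        using order_mult[of "char_poly (E1 \<zeta>)" "char_poly (E2 \<zeta>)" x] by (simp add: cp[OF \<zeta>])
      moreover have "order x (char_poly (E2 \<zeta>)) \<le> 1"
        using blocks[OF \<zeta>] by (auto simp: simple_eigenvalues_def rsquarefree_def dest!: spec[of _ x])
      ultimately have "order x (char_poly (E1 \<zeta>)) \<noteq> 0" using x by linarith
      then have "poly (char_poly (E1 \<zeta>)) x = 0" by (metis order_root)
      then have "(2 * x - \<tau> \<zeta>)\<^sup>2 = 0"
        using blocks[OF \<zeta>] \<delta>0 by (simp add: char_poly_root_iff_Delta \<tau>_def \<delta>_def)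
      then show "x = \<tau> \<zeta> / 2" by (simp add: field_simps)
    qed
  qed (use R(2) L \<delta>0 in auto)
qed

text \<open>Applied to labels, this forbids a second coalescence at a cuspidal point: pairs in
  different groups would coalesce at different values.\<close>

lemma gcp_multiple_eigenvalue_unique:
  assumes "gcp n k \<Omega> A \<zeta>" "1 \<le> k" "2 \<le> n" "\<And>\<xi>. \<xi> \<in> \<Omega> \<Longrightarrow> A \<xi> \<in> carrier_mat n n"
    and "2 \<le> order x (char_poly (A \<zeta>))" "2 \<le> order y (char_poly (A \<zeta>))"
  shows "x = y"
proof -
  obtain N \<tau> \<delta> L where "open N" "\<zeta> \<in> N" "continuous_on N \<tau>" "(\<delta> has_derivative L) (at \<zeta>)"
    "inj L" "\<delta> \<zeta> = 0"
    "\<forall>\<xi>\<in>N. \<forall>s. s\<^sup>2 = \<delta> \<xi> \<longrightarrow> poly (char_poly (A \<xi>)) ((\<tau> \<xi> + s) / 2) = 0"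
    and double: "\<forall>x. 2 \<le> order x (char_poly (A \<zeta>)) \<longrightarrow> x = \<tau> \<zeta> / 2"
    by (rule gcp_local_discriminant[OF assms(1-4)])
  from double assms(5,6) have "x = \<tau> \<zeta> / 2" "y = \<tau> \<zeta> / 2" by blast+
  then show ?thesis by (simp only:)
qed

context spectral_groups
begin

text \<open>Near \<zeta> the two roots provided by the block, half of \<tau> plus or minus a square
  root of \<delta>, are eigenvalues close to the double one and hence carry the labels
  \<open>a\<close> and \<open>b\<close>. Their squared difference is \<delta>, so the derivative of
  \<delta> is inherited.\<close>

lemma diff_squared_has_derivative:
  assumes "{a, b} \<in> \<G>" "a \<noteq> b" "gcp n k \<Omega> A \<zeta>" "1 \<le> k" "lam \<zeta> a = lam \<zeta> b"
  obtains L where "((\<lambda>\<xi>. (lam \<xi> a - lam \<xi> b)\<^sup>2) has_derivative L) (at \<zeta>)" "inj L"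
proof -
  have \<zeta>: "\<zeta> \<in> \<Omega>" using assms(3) by (simp add: gcp_def)
  have ab: "a < n" "b < n" using assms(1) Union_groups by auto
  then have n: "2 \<le> n" using assms(2) by linarith
  obtain N \<tau> \<delta> L where N: "open N" "\<zeta> \<in> N" and \<tau>: "continuous_on N \<tau>"
    and L: "(\<delta> has_derivative L) (at \<zeta>)" "inj L" and \<delta>0: "\<delta> \<zeta> = 0"
    and roots: "\<forall>\<xi>\<in>N. \<forall>s. s\<^sup>2 = \<delta> \<xi> \<longrightarrow> poly (char_poly (A \<xi>)) ((\<tau> \<xi> + s) / 2) = 0"
    and double: "\<forall>x. 2 \<le> order x (char_poly (A \<zeta>)) \<longrightarrow> x = \<tau> \<zeta> / 2"
    by (rule gcp_local_discriminant[OF assms(3,4) n carrier])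
  have \<tau>0: "lam \<zeta> a = \<tau> \<zeta> / 2"
    using double order_labelled_ge_2[OF labelled[OF \<zeta>] ab assms(2,5)] by blast
  obtain U where U: "open U" "lam \<zeta> ` {a, b} \<subseteq> U" "\<forall>\<^sub>F \<xi> in nhds \<zeta>. \<forall>i<n. lam \<xi> i \<in> U \<longleftrightarrow> i \<in> {a, b}"
    using group_isolated[OF \<zeta> assms(1)] .
  have lim\<tau>: "(\<tau> \<longlongrightarrow> \<tau> \<zeta>) (nhds \<zeta>)"
    using \<tau> N by (simp add: continuous_on_eq_continuous_at isCont_def flip: tendsto_at_iff_tendsto_nhds)
  have "isCont \<delta> \<zeta>" using L(1) has_derivative_continuous by blast
  then have "(\<delta> \<longlongrightarrow> 0) (nhds \<zeta>)"
    using \<delta>0 tendsto_at_iff_tendsto_nhds[of \<delta> \<zeta>] by (simp add: isCont_def)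
  \<comment> \<open>\<open>csqrt\<close> jumps across a branch cut, but its modulus is the real
    square root of the modulus, which suffices for a limit equal to 0.\<close>
  then have "((\<lambda>\<xi>. sqrt (norm (\<delta> \<xi>))) \<longlongrightarrow> sqrt (norm (0::complex))) (nhds \<zeta>)"
    by (intro tendsto_intros)
  then have "((\<lambda>\<xi>. norm (csqrt (\<delta> \<xi>))) \<longlongrightarrow> 0) (nhds \<zeta>)"
    by simp
  then have lims: "((\<lambda>\<xi>. csqrt (\<delta> \<xi>)) \<longlongrightarrow> 0) (nhds \<zeta>)"
    by (rule tendsto_norm_zero_cancel)
  have "((\<lambda>\<xi>. (\<tau> \<xi> + csqrt (\<delta> \<xi>)) / 2) \<longlongrightarrow> (\<tau> \<zeta> + 0) / 2) (nhds \<zeta>)"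
    by (intro tendsto_intros lim\<tau> lims) simp
  then have plus: "\<forall>\<^sub>F \<xi> in nhds \<zeta>. (\<tau> \<xi> + csqrt (\<delta> \<xi>)) / 2 \<in> U"
    using U(1,2) \<tau>0 by (intro topological_tendstoD) auto
  have "((\<lambda>\<xi>. (\<tau> \<xi> + - csqrt (\<delta> \<xi>)) / 2) \<longlongrightarrow> (\<tau> \<zeta> + - 0) / 2) (nhds \<zeta>)"
    by (intro tendsto_intros lim\<tau> lims) simp
  then have minus: "\<forall>\<^sub>F \<xi> in nhds \<zeta>. (\<tau> \<xi> + - csqrt (\<delta> \<xi>)) / 2 \<in> U"
    using U(1,2) \<tau>0 by (intro topological_tendstoD) auto
  obtain c where c: "c > 0" "\<And>v. c * norm v \<le> norm (L v)"
    using linear_inj_bounded_below_pos[OF has_derivative_linear[OF L(1)] L(2)] by blast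
  \<comment> \<open>Where \<delta> vanishes the two roots coincide and need not exhaust the labels
    \<open>a\<close> and \<open>b\<close>. The derivative, bounded below by \<open>c\<close>,
    dominates a remainder with factor \<open>c / 2\<close> and excludes such zeros in a punctured
    neighbourhood.\<close>
  have nz: "\<forall>\<^sub>F \<xi> in at \<zeta>. \<delta> \<xi> \<noteq> 0"
  proof -
    obtain d where d: "d > 0" "\<And>\<xi>. norm (\<xi> - \<zeta>) < d \<Longrightarrow> norm (\<delta> \<xi> - \<delta> \<zeta> - L (\<xi> - \<zeta>)) \<le> c / 2 * norm (\<xi> - \<zeta>)"
      using L(1) c(1) unfolding has_derivative_at_alt by (meson half_gt_zero)
    have "\<delta> \<xi> \<noteq> 0" if "\<xi> \<noteq> \<zeta>" "dist \<xi> \<zeta> < d" for \<xi>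
    proof
      assume "\<delta> \<xi> = 0"
      then have "norm (L (\<xi> - \<zeta>)) \<le> c / 2 * norm (\<xi> - \<zeta>)"
        using d(2)[of \<xi>] that(2) \<delta>0 by (simp add: dist_norm)
      with c(2)[of "\<xi> - \<zeta>"] have "c * norm (\<xi> - \<zeta>) \<le> c / 2 * norm (\<xi> - \<zeta>)" by linarith
      then show False using c(1) that(1) by simp
    qed
    then show ?thesis using d(1) by (auto simp: eventually_at)
  qed
  have "\<forall>\<^sub>F \<xi> in nhds \<zeta>. \<xi> \<in> N" using N eventually_nhds by blast
  from this eventually_dom[OF \<zeta>] U(3) plus minus
  have "\<forall>\<^sub>F \<xi> in nhds \<zeta>. \<delta> \<xi> \<noteq> 0 \<longrightarrow> \<delta> \<xi> = (lam \<xi> a - lam \<xi> b)\<^sup>2"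
  proof eventually_elim
    case (elim \<xi>)
    have root: "(\<tau> \<xi> + s) / 2 \<in> {lam \<xi> a, lam \<xi> b}" if "s\<^sup>2 = \<delta> \<xi>" "(\<tau> \<xi> + s) / 2 \<in> U" for s
    proof -
      have "(\<tau> \<xi> + s) / 2 \<in> lam \<xi> ` {..<n}"
        using bspec[OF roots elim(1)] that(1) labelled_root_iff[OF labelled[OF elim(2)]] by simp
      then obtain i where "i < n" "(\<tau> \<xi> + s) / 2 = lam \<xi> i" by auto
      with elim(3) that(2) show ?thesis by auto
    qed
    let ?s = "csqrt (\<delta> \<xi>)"
    have 1: "(\<tau> \<xi> + ?s) / 2 \<in> {lam \<xi> a, lam \<xi> b}" "(\<tau> \<xi> + - ?s) / 2 \<in> {lam \<xi> a, lam \<xi> b}"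
      using root[of ?s] root[of "- ?s"] elim(4,5) by simp_all
    show ?case
    proof
      assume "\<delta> \<xi> \<noteq> 0"
      define x y where "x = (\<tau> \<xi> + ?s) / 2" and "y = (\<tau> \<xi> + - ?s) / 2"
      have xy: "x - y = ?s" by (simp add: x_def y_def field_simps)
      then have "x \<noteq> y" using \<open>\<delta> \<xi> \<noteq> 0\<close> by auto
      with 1 have "(x - y)\<^sup>2 = (lam \<xi> a - lam \<xi> b)\<^sup>2"
        unfolding x_def[symmetric] y_def[symmetric] by (auto simp: power2_commute)
      then show "\<delta> \<xi> = (lam \<xi> a - lam \<xi> b)\<^sup>2" by (simp add: xy)
    qed
  qed
  then have "\<forall>\<^sub>F \<xi> in at \<zeta>. \<delta> \<xi> \<noteq> 0 \<longrightarrow> \<delta> \<xi> = (lam \<xi> a - lam \<xi> b)\<^sup>2"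
    by (simp add: eventually_nhds_conv_at)
  then have "\<forall>\<^sub>F \<xi> in at \<zeta>. \<delta> \<xi> = (lam \<xi> a - lam \<xi> b)\<^sup>2"
    using nz by eventually_elim simp
  then have "((\<lambda>\<xi>. (lam \<xi> a - lam \<xi> b)\<^sup>2) has_derivative L) (at \<zeta>)"
    using \<delta>0 assms(5) by (intro has_derivative_transform_eventually[OF L(1)]) auto
  with L(2) that show thesis by blast
qed

end

section \<open>Winding around a simple zero\<close>

text \<open>Both spaces have real dimension 2, but they are different types, so surjectivity is read
  off the dimension of the range.\<close>

lemma linear_inj_imp_surj_complex:
  fixes L :: "real^2 \<Rightarrow> complex"
  assumes "linear L" "inj L"
  shows "surj L"
proof -
  have "dim (range L) = dim (UNIV :: (real^2) set)"
    using assms by (intro dim_image_eq) (auto simp: inj_on_def inj_def)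
  then have "dim (range L) = DIM(complex)" by simp
  then have "span (range L) = UNIV" by (simp only: dim_eq_full)
  moreover have "span (range L) = range L"
    using linear_subspace_image[OF assms(1) subspace_UNIV] by (simp add: span_eq_iff)
  ultimately show ?thesis by simp
qed

text \<open>The inverse \<open>g\<close> sends the component of \<open>f z\<close> off the image of
  \<open>S\<close> into the bounded component of \<open>z\<close> off \<open>S\<close>. What it
  produces has compact closure, and applying \<open>f\<close> to that closure bounds the original
  component.\<close>

lemma inside_homeomorphism_image:
  fixes f :: "'a::heine_borel \<Rightarrow> 'b::heine_borel"
  assumes "homeomorphism UNIV UNIV f g" "z \<in> inside S"
  shows "f z \<in> inside (f ` S)"
proof -
  let ?C = "connected_component_set (- f ` S) (f z)"
  have contf: "continuous_on UNIV f" and contg: "continuous_on UNIV g"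
    and gf: "g (f x) = x" and fg: "f (g y) = y" for x y
    using assms(1) by (auto simp: homeomorphism_def)
  have z: "z \<notin> S" "bounded (connected_component_set (- S) z)"
    using assms(2) by (auto simp: inside_def)
  have fz: "f z \<notin> f ` S" using z(1) gf by (metis imageE)
  have "g ` ?C \<subseteq> connected_component_set (- S) z"
  proof (rule connected_component_maximal)
    have "f z \<in> ?C" using fz by simp
    then show "z \<in> g ` ?C" by (rule image_eqI[rotated]) (simp add: gf)
    show "connected (g ` ?C)"
      by (intro connected_continuous_image connected_connected_component continuous_on_subset[OF contg]) simp
    have sub: "?C \<subseteq> - f ` S" by (rule connected_component_subset)
    show "g ` ?C \<subseteq> - S"
    proof (rule image_subsetI, rule ComplI)
      fix y assume "y \<in> ?C" "g y \<in> S"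
      then have "y \<in> f ` S" using fg[of y] by (metis imageI)
      with sub \<open>y \<in> ?C\<close> show False by blast
    qed
  qed
  then have "bounded (g ` ?C)" using z(2) by (rule bounded_subset[rotated])
  then have "compact (f ` closure (g ` ?C))"
    by (intro compact_continuous_image continuous_on_subset[OF contf]) simp_all
  moreover have "?C \<subseteq> f ` closure (g ` ?C)"
  proof
    fix x assume "x \<in> ?C"
    then have "g x \<in> closure (g ` ?C)" by (intro subsetD[OF closure_subset] imageI)
    then show "x \<in> f ` closure (g ` ?C)" using fg[of x] by force
  qed
  ultimately have "bounded ?C" using compact_imp_bounded bounded_subset by blast
  with fz show ?thesis by (simp add: inside_def)
qed

text \<open>Since \<open>D\<close> vanishes only at \<open>\<zeta>\<close>, and to first order there, it equals its linearization times
  the exponential of a continuous function, so along the curve it winds around 0 as often as the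
  linear image of the curve, that is, once.\<close>

lemma simple_zero_encircled_log:
  fixes D :: "real^2 \<Rightarrow> complex" and \<gamma> :: "real \<Rightarrow> real^2"
  assumes "convex \<Omega>" "open \<Omega>" "continuous_on \<Omega> D"
    and nz: "\<And>\<xi>. \<lbrakk>\<xi> \<in> \<Omega>; \<xi> \<noteq> \<zeta>\<rbrakk> \<Longrightarrow> D \<xi> \<noteq> 0"
    and zero: "D \<zeta> = 0" and deriv: "(D has_derivative L) (at \<zeta>)" and inj: "inj L"
    and path: "simple_path \<gamma>" "pathfinish \<gamma> = pathstart \<gamma>" "path_image \<gamma> \<subseteq> \<Omega>"
      "\<zeta> \<in> inside (path_image \<gamma>)"
  obtains w where "continuous_on {0..1} w" "\<forall>t\<in>{0..1}. D (\<gamma> t) = exp (w t)"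
    "exp ((w 1 - w 0) / 2) = - 1"
proof -
  have lin: "linear L" using deriv by (rule has_derivative_linear)
  have L0: "L v = 0 \<longleftrightarrow> v = 0" for v
    using linear_0[OF lin] inj by (metis injD)
  have contL: "continuous_on S (\<lambda>\<xi>. L (\<xi> - \<zeta>))" for S
    by (intro continuous_on_compose2[OF linear_continuous_on[of L UNIV]] continuous_intros)
      (use lin in \<open>auto simp: linear_conv_bounded_linear\<close>)
  \<comment> \<open>The value 1 at \<zeta> is the limit of the quotient, so \<open>h\<close> is
    continuous and without zeros on all of \<Omega>; contractibility then provides a
    logarithm.\<close>
  define h where "h = (\<lambda>\<xi>. if \<xi> = \<zeta> then 1 else D \<xi> / L (\<xi> - \<zeta>))"
  have "isCont h \<zeta>"
  proof -
    obtain c where c: "c > 0" "\<And>v. c * norm v \<le> norm (L v)"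
      using linear_inj_bounded_below_pos[OF lin inj] by blast
    have "\<forall>\<^sub>F \<xi> in at \<zeta>. dist (h \<xi>) 1 < e" if "e > 0" for e
    proof -
      \<comment> \<open>The factor \<open>c\<close> cancels against the lower bound for
        \<open>L\<close>; the half makes the final estimate strict.\<close>
      have "c * (e / 2) > 0" using c(1) that by simp
      then obtain d where d: "d > 0"
        "\<And>\<xi>. norm (\<xi> - \<zeta>) < d \<Longrightarrow> norm (D \<xi> - D \<zeta> - L (\<xi> - \<zeta>)) \<le> c * (e / 2) * norm (\<xi> - \<zeta>)"
        using deriv unfolding has_derivative_at_alt by meson
      have "dist (h \<xi>) 1 < e" if \<xi>: "\<xi> \<noteq> \<zeta>" "dist \<xi> \<zeta> < d" for \<xi>
      proof -
        have "norm (D \<xi> - L (\<xi> - \<zeta>)) \<le> (e / 2) * (c * norm (\<xi> - \<zeta>))"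
          using d(2)[of \<xi>] \<xi>(2) zero by (simp add: dist_norm algebra_simps)
        also have "\<dots> \<le> (e / 2) * norm (L (\<xi> - \<zeta>))"
          using c(2) \<open>e > 0\<close> by (intro mult_left_mono) auto
        also have "\<dots> < e * norm (L (\<xi> - \<zeta>))"
          using \<xi>(1) L0[of "\<xi> - \<zeta>"] \<open>e > 0\<close> by simp
        finally have "norm (D \<xi> - L (\<xi> - \<zeta>)) / norm (L (\<xi> - \<zeta>)) < e"
          using \<xi>(1) L0[of "\<xi> - \<zeta>"] by (simp add: divide_less_eq)
        moreover have "h \<xi> - 1 = (D \<xi> - L (\<xi> - \<zeta>)) / L (\<xi> - \<zeta>)"
          using \<xi>(1) L0[of "\<xi> - \<zeta>"] by (simp add: h_def diff_divide_distrib)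
        ultimately show ?thesis by (simp add: dist_norm norm_divide)
      qed
      then show ?thesis using d(1) by (auto simp: eventually_at)
    qed
    then have "(h \<longlongrightarrow> 1) (at \<zeta>)" by (rule tendstoI)
    then show ?thesis by (simp add: isCont_def h_def)
  qed
  moreover have "isCont h \<xi>" if "\<xi> \<in> \<Omega>" "\<xi> \<noteq> \<zeta>" for \<xi>
  proof -
    have "continuous_on (\<Omega> - {\<zeta>}) (\<lambda>\<xi>. D \<xi> / L (\<xi> - \<zeta>))"
      using assms(3) by (intro continuous_on_divide contL) (auto intro: continuous_on_subset simp: L0)
    then have "continuous_on (\<Omega> - {\<zeta>}) h"
      by (rule continuous_on_cong[THEN iffD1, rotated -1]) (auto simp: h_def)
    moreover have "open (\<Omega> - {\<zeta>})" using assms(2) by (simp add: open_delete)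
    ultimately show ?thesis using that continuous_on_eq_continuous_at by blast
  qed
  ultimately have "continuous_on \<Omega> h"
    by (intro continuous_at_imp_continuous_on) blast
  moreover have "h \<xi> \<noteq> 0" if "\<xi> \<in> \<Omega>" for \<xi>
    using nz[OF that] L0[of "\<xi> - \<zeta>"] by (simp add: h_def)
  moreover have "contractible \<Omega>" by (rule convex_imp_contractible[OF assms(1)])
  ultimately obtain g where g: "continuous_on \<Omega> g" "\<And>\<xi>. \<xi> \<in> \<Omega> \<Longrightarrow> h \<xi> = exp (g \<xi>)"
    using continuous_logarithm_on_contractible by blast
  \<comment> \<open>The linearization sees only this curve, which is again simple and closed. The
    homeomorphism below carries the encircled point \<zeta> to 0, so the winding number is 1 or -1;
    either sign leads to -1 once the logarithmic increment is halved.\<close>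
  define p where "p = L \<circ> (\<lambda>t. \<gamma> t + - \<zeta>)"
  have "simple_path (\<lambda>t. \<gamma> t + - \<zeta>)"
    using path(1) simple_path_translation_eq[of "- \<zeta>" \<gamma>] by (simp add: o_def add.commute)
  then have p: "simple_path p" unfolding p_def simple_path_linear_image_eq[OF lin inj] .
  obtain M where M: "linear M" "M \<circ> L = id"
    using linear_injective_left_inverse[OF lin inj] by blast
  then have left_inv: "M (L v) = v" for v by (simp add: fun_eq_iff)
  then have right_inv: "L (M z) = z" for z
    using linear_inj_imp_surj_complex[OF lin inj] by (metis surjD)
  have "homeomorphism UNIV UNIV (\<lambda>\<xi>. L (\<xi> - \<zeta>)) (\<lambda>z. M z + \<zeta>)"
    using M(1) by (intro homeomorphismI contL continuous_on_add continuous_on_const linear_continuous_on)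
      (simp_all add: linear_conv_bounded_linear left_inv right_inv)
  from inside_homeomorphism_image[OF this path(4)]
  have zin: "0 \<in> inside (path_image p)"
    by (simp add: linear_0[OF lin] p_def path_image_def image_image)
  then have "0 \<notin> path_image p" using inside_no_overlap by blast
  then obtain q where q: "path q" "pathfinish q - pathstart q = 2 * of_real pi * \<i> * winding_number p 0"
    "\<And>t. t \<in> {0..1} \<Longrightarrow> p t = 0 + exp (q t)"
    using winding_number_as_continuous_log[OF simple_path_imp_path[OF p], of 0] by blast
  have wn: "winding_number p 0 = 1 \<or> winding_number p 0 = - 1"
    using simple_closed_path_winding_number_inside[OF p] zin by blast
  show thesis
  proof (rule that[of "\<lambda>t. q t + g (\<gamma> t)"])
    have \<gamma>: "continuous_on {0..1} \<gamma>" "\<gamma> ` {0..1} \<subseteq> \<Omega>"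
      using simple_path_imp_path[OF path(1)] path(3) by (auto simp: path_def path_image_def)
    show "continuous_on {0..1} (\<lambda>t. q t + g (\<gamma> t))"
      using q(1) by (intro continuous_on_add continuous_on_compose2[OF g(1) \<gamma>]) (auto simp: path_def)
    show "\<forall>t\<in>{0..1}. D (\<gamma> t) = exp (q t + g (\<gamma> t))"
    proof
      fix t :: real assume t: "t \<in> {0..1}"
      have "\<gamma> t \<in> path_image \<gamma>" using t by (auto simp: path_image_def)
      then have "\<gamma> t \<in> \<Omega>" "\<gamma> t \<noteq> \<zeta>"
        using path(3,4) inside_no_overlap by blast+
      then show "D (\<gamma> t) = exp (q t + g (\<gamma> t))"
        using g(2)[of "\<gamma> t"] q(3)[OF t] L0[of "\<gamma> t - \<zeta>"] by (simp add: exp_add h_def p_def field_simps)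
    qed
    \<comment> \<open>The correction \<open>g\<close> depends on the point alone and the curve is
      closed, so only the increment of \<open>q\<close> survives.\<close>
    have "(q 1 + g (\<gamma> 1) - (q 0 + g (\<gamma> 0))) / 2 = (q 1 - q 0) / 2"
      using path(2) by (simp add: pathfinish_def pathstart_def)
    also have "\<dots> = of_real pi * \<i> * winding_number p 0"
      using q(2) by (simp add: pathfinish_def pathstart_def)
    finally show "exp ((q 1 + g (\<gamma> 1) - (q 0 + g (\<gamma> 0))) / 2) = - 1"
      using wn by (auto simp: exp_minus mult.commute[of "of_real pi"])
  qed
qed

text \<open>Dividing \<open>f\<close> by the continuous branch \<open>exp (w t / 2)\<close> of the
  square root leaves a continuous function with values 1 and -1, which is constant on the
  interval.\<close>

lemma square_root_of_exp:
  fixes f w :: "real \<Rightarrow> complex"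
  assumes "continuous_on {0..1} f" "continuous_on {0..1} w" "\<forall>t\<in>{0..1}. (f t)\<^sup>2 = exp (w t)"
  shows "f 1 = exp ((w 1 - w 0) / 2) * f 0"
proof -
  define q where "q = (\<lambda>t. f t / exp (w t / 2))"
  have "(q t)\<^sup>2 = 1" if "t \<in> {0..1}" for t
    using assms(3) that by (simp add: q_def power_divide flip: exp_double)
  then have "q ` {0..1} \<subseteq> {1, -1}" using power2_eq_1_iff by blast
  then have "finite (q ` {0..1})" by (rule finite_subset) simp
  moreover have "continuous_on {0..1} q"
    unfolding q_def by (intro continuous_intros assms) auto
  ultimately have "q constant_on {0..1}"
    by (intro continuous_finite_range_constant) (auto simp: connected_iff_interval)
  then have "q 1 = q 0" unfolding constant_on_def by (metis atLeastAtMost_iff order_refl zero_le_one)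
  then have "f 1 = exp (w 1 / 2) * (f 0 / exp (w 0 / 2))"
    by (simp add: q_def field_simps)
  also have "\<dots> = exp ((w 1 - w 0) / 2) * f 0"
    by (simp add: diff_divide_distrib exp_diff)
  finally show ?thesis .
qed

section \<open>Periodic curves as simple closed paths\<close>

lemma periodic_path_image:
  fixes \<gamma> :: "real \<Rightarrow> 'a::topological_space"
  assumes "\<And>t. \<gamma> (t + 1) = \<gamma> t"
  shows "path_image \<gamma> = range \<gamma>"
proof -
  interpret periodic_fun_simple' \<gamma> by unfold_locales (rule assms)
  have "\<gamma> t \<in> path_image \<gamma>" for t
  proof -
    have "\<gamma> (frac t) = \<gamma> t"
      using plus_of_int[of "frac t" "\<lfloor>t\<rfloor>"] by (simp add: frac_def)
    moreover have "frac t \<in> {0..1}"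
      using frac_ge_0[of t] frac_lt_1[of t] by (simp add: less_imp_le)
    ultimately show ?thesis unfolding path_image_def by (metis imageI)
  qed
  then show ?thesis by (auto simp: path_image_def)
qed

lemma periodic_simple_path:
  fixes \<gamma> :: "real \<Rightarrow> 'a::topological_space"
  assumes "\<And>t. \<gamma> (t + 1) = \<gamma> t" "continuous_on UNIV \<gamma>" "inj_on \<gamma> {0..<1}"
  shows "simple_path \<gamma>" "pathfinish \<gamma> = pathstart \<gamma>"
proof -
  have 10: "\<gamma> 1 = \<gamma> 0" using assms(1)[of 0] by simp
  then show "pathfinish \<gamma> = pathstart \<gamma>" by (simp add: pathfinish_def pathstart_def)
  have "x = y \<or> x = 0 \<and> y = 1 \<or> x = 1 \<and> y = 0"
    if xy: "x \<in> {0..1}" "y \<in> {0..1}" "\<gamma> x = \<gamma> y" for x y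
  proof (cases "x = 1")
    case True
    show ?thesis
    proof (cases "y = 1")
      case False
      then have "y = 0" using xy(2,3) True 10 by (intro inj_onD[OF assms(3)]) auto
      then show ?thesis using True by simp
    qed (use True in simp)
  next
    case False
    then have x: "x \<in> {0..<1}" using xy(1) by simp
    show ?thesis
    proof (cases "y = 1")
      case True
      then have "x = 0" using xy(3) x 10 by (intro inj_onD[OF assms(3)]) auto
      then show ?thesis using True by simp
    next
      case False
      then have "x = y" using xy(2,3) x by (intro inj_onD[OF assms(3)]) auto
      then show ?thesis by simp
    qed
  qed
  then show "simple_path \<gamma>"
    using continuous_on_subset[OF assms(2)] by (simp add: simple_path_def loop_free_def path_def)
qed

section \<open>Eigenvalues along a closed curve\<close>

text \<open>Distinct labels never meet, so the real line is the disjoint union of finitely many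
  closed sets, on each of which \<open>f\<close> agrees with one label. Each of these sets is also
  open, hence empty or everything.\<close>

lemma continuous_label_constant:
  fixes mu :: "real \<Rightarrow> nat \<Rightarrow> complex"
  assumes "\<And>j. j < n \<Longrightarrow> continuous_on UNIV (\<lambda>t. mu t j)" "\<And>t. inj_on (mu t) {..<n}"
    and "continuous_on UNIV f" "\<And>t. f t \<in> mu t ` {..<n}"
    and "j < n" "f s = mu s j"
  shows "f t = mu t j"
proof -
  define Z where "Z = (\<lambda>i. {t. f t = mu t i})"
  have closed: "closed (Z i)" if "i < n" for i
    unfolding Z_def by (intro closed_Collect_eq assms(1,3) that)
  have "- Z j = (\<Union>i\<in>{..<n} - {j}. Z i)"
  proof (intro equalityI subsetI)
    fix t assume t: "t \<in> - Z j"
    obtain i where i: "i < n" "f t = mu t i" using assms(4)[of t] by auto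
    then have "i \<noteq> j" using t by (auto simp: Z_def)
    then show "t \<in> (\<Union>i\<in>{..<n} - {j}. Z i)" using i by (auto simp: Z_def)
  next
    fix t assume "t \<in> (\<Union>i\<in>{..<n} - {j}. Z i)"
    then obtain i where "i < n" "i \<noteq> j" "f t = mu t i" by (auto simp: Z_def)
    then show "t \<in> - Z j" using inj_onD[OF assms(2)[of t], of i j] assms(5) by (auto simp: Z_def)
  qed
  then have "closed (- Z j)" using closed by (auto intro!: closed_UN)
  then have "Z j = {} \<or> Z j = UNIV"
    using closed[OF assms(5)] clopen[of "Z j"] by (simp add: closed_def)
  moreover have "s \<in> Z j" using assms(6) by (simp add: Z_def)
  ultimately have "Z j = UNIV" by blast
  then show ?thesis by (auto simp: Z_def)
qed

locale spectral_groups_curve = spectral_groups +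
  fixes \<gamma> :: "real \<Rightarrow> real^2"
  assumes curve_cont: "continuous_on UNIV \<gamma>" and curve_range: "range \<gamma> \<subseteq> \<Omega>"
    and curve_period: "\<And>t. \<gamma> (t + 1) = \<gamma> t"
begin

lemma curve_in_dom: "\<gamma> t \<in> \<Omega>"
  using curve_range by auto

text \<open>Connectedness is used with open sets here, since \<open>lam\<close> may jump along the
  curve. An isolating neighbourhood of a group traps the continuous \<open>f\<close> at nearby
  times, so the times spent in the various groups form disjoint open sets covering the real
  line.\<close>

lemma eigenvalue_stays_in_group:
  assumes "continuous_on UNIV f" "\<And>t. f t \<in> lam (\<gamma> t) ` {..<n}" "G \<in> \<G>" "f s \<in> lam (\<gamma> s) ` G"
  shows "f t \<in> lam (\<gamma> t) ` G"
proof -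
  define Z where "Z = (\<lambda>H. {t. f t \<in> lam (\<gamma> t) ` H})"
  have "open (Z H)" if H: "H \<in> \<G>" for H
  proof (subst open_subopen, intro ballI)
    fix t assume t: "t \<in> Z H"
    obtain U where U: "open U" "lam (\<gamma> t) ` H \<subseteq> U" "\<forall>\<^sub>F \<eta> in nhds (\<gamma> t). \<forall>i<n. lam \<eta> i \<in> U \<longleftrightarrow> i \<in> H"
      using group_isolated[OF curve_in_dom H] .
    have lim: "(g \<longlongrightarrow> g t) (nhds t)" if "continuous_on UNIV g" for g :: "real \<Rightarrow> 'b::topological_space"
      using that by (simp add: continuous_on_eq_continuous_at isCont_def flip: tendsto_at_iff_tendsto_nhds)
    have "\<forall>\<^sub>F u in nhds t. \<forall>i<n. lam (\<gamma> u) i \<in> U \<longleftrightarrow> i \<in> H"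
      using U(3) lim[OF curve_cont] by (rule eventually_compose_filterlim)
    moreover have "f t \<in> U" using t U(2) by (auto simp: Z_def)
    then have "\<forall>\<^sub>F u in nhds t. f u \<in> U"
      by (intro topological_tendstoD[OF lim[OF assms(1)] U(1)])
    ultimately have "\<forall>\<^sub>F u in nhds t. u \<in> Z H"
    proof eventually_elim
      case (elim u)
      obtain i where "i < n" "f u = lam (\<gamma> u) i" using assms(2)[of u] by auto
      with elim show ?case by (auto simp: Z_def)
    qed
    then show "\<exists>T. open T \<and> t \<in> T \<and> T \<subseteq> Z H" unfolding eventually_nhds by blast
  qed
  note open_Z = this
  have "- Z G = (\<Union>H\<in>\<G> - {G}. Z H)"
  proof (intro equalityI subsetI)
    fix t assume t: "t \<in> - Z G"
    obtain i where i: "i < n" "f t = lam (\<gamma> t) i" using assms(2)[of t] by auto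
    then obtain H where "H \<in> \<G>" "i \<in> H" using Union_groups by auto
    then show "t \<in> (\<Union>H\<in>\<G> - {G}. Z H)" using i t by (auto simp: Z_def)
  next
    fix t assume "t \<in> (\<Union>H\<in>\<G> - {G}. Z H)"
    then obtain H where H: "H \<in> \<G>" "G \<noteq> H" "f t \<in> lam (\<gamma> t) ` H" by (auto simp: Z_def)
    have "lam (\<gamma> t) ` G \<inter> lam (\<gamma> t) ` H = {}"
      using groups[unfolded eigenvalue_groups_def, THEN conjunct1, rule_format,
          OF curve_in_dom assms(3) H(1)] H(2) by simp
    then show "t \<in> - Z G" using H(3) by (auto simp: Z_def)
  qed
  then have "open (- Z G)" using open_Z by auto
  then have "Z G = {} \<or> Z G = UNIV"
    using open_Z[OF assms(3)] clopen[of "Z G"] by (simp add: closed_def)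
  moreover have "s \<in> Z G" using assms(4) by (simp add: Z_def)
  ultimately have "Z G = UNIV" by blast
  then show ?thesis by (auto simp: Z_def)
qed

text \<open>Both \<open>f\<close> and a continuous selection \<open>g\<close> on \<Omega>, taken
  along the curve, lift \<gamma> to the graph of the group. They agree at time 0, hence always, so
  \<open>f t\<close> depends on the point \<open>\<gamma> t\<close> only.\<close>

lemma eigenvalue_of_simple_group_periodic:
  assumes G: "G \<in> \<G>" and inj: "\<And>\<xi>. \<xi> \<in> \<Omega> \<Longrightarrow> inj_on (lam \<xi>) G" and "convex \<Omega>"
    and f: "continuous_on UNIV f" "\<And>t. f t \<in> lam (\<gamma> t) ` G"
  shows "f (t + 1) = f t"
proof -
  obtain j where j: "j \<in> G" "f 0 = lam (\<gamma> 0) j" using f(2)[of 0] by blast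
  obtain g where g: "continuous_on \<Omega> g" "g (\<gamma> 0) = lam (\<gamma> 0) j" "\<And>\<eta>. \<eta> \<in> \<Omega> \<Longrightarrow> g \<eta> \<in> lam \<eta> ` G"
    using continuous_selection[OF G inj \<open>convex \<Omega>\<close> curve_in_dom j(1)] by blast
  have "G \<noteq> {}" using j by auto
  have "(\<gamma> t, f t) = (\<gamma> t, g (\<gamma> t))" for t
  proof (rule covering_space_lift_unique[OF covering_space_group[OF G inj \<open>G \<noteq> {}\<close>],
        of "\<lambda>t. (\<gamma> t, f t)" 0 "\<lambda>t. (\<gamma> t, g (\<gamma> t))" UNIV \<gamma> t])
    show "continuous_on UNIV (\<lambda>t. (\<gamma> t, g (\<gamma> t)))"
      using curve_in_dom by (intro continuous_intros curve_cont continuous_on_compose2[OF g(1)]) auto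
    show "continuous_on UNIV (\<lambda>t. (\<gamma> t, f t))"
      by (intro continuous_intros curve_cont f(1))
  qed (use curve_cont curve_in_dom f(2) g(2,3) j(2) in auto)
  then have "f t = g (\<gamma> t)" for t by simp
  then show ?thesis by (simp add: curve_period)
qed

text \<open>Closedness of the curve fixes only the unordered pair of values after one turn. The
  order is decided by the difference \<open>f t - g t\<close>, a continuous square root that picks
  up the factor -1 and is not 0.\<close>

lemma pair_swapped:
  assumes pair: "{a, b} \<in> \<G>" "a \<noteq> b" and gcp: "gcp n k \<Omega> A \<zeta>" "1 \<le> k" "lam \<zeta> a = lam \<zeta> b"
    and "convex \<Omega>" and simple: "\<And>\<xi>. \<lbrakk>\<xi> \<in> \<Omega>; \<xi> \<noteq> \<zeta>\<rbrakk> \<Longrightarrow> lam \<xi> a \<noteq> lam \<xi> b"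
    and curve: "inj_on \<gamma> {0..<1}" "\<zeta> \<in> inside (range \<gamma>)"
    and f: "continuous_on UNIV f" and g: "continuous_on UNIV g"
    and fg: "\<And>t. {f t, g t} = {lam (\<gamma> t) a, lam (\<gamma> t) b}"
  shows "f 1 = g 0" "g 1 = f 0"
proof -
  let ?D = "\<lambda>\<xi>. (lam \<xi> a - lam \<xi> b)\<^sup>2"
  obtain L where L: "(?D has_derivative L) (at \<zeta>)" "inj L"
    using diff_squared_has_derivative[OF pair gcp] by blast
  have image: "path_image \<gamma> = range \<gamma>" by (rule periodic_path_image[of \<gamma>, OF curve_period])
  have nz: "?D \<xi> \<noteq> 0" if "\<xi> \<in> \<Omega>" "\<xi> \<noteq> \<zeta>" for \<xi> using simple[OF that] by simp
  have \<zeta>0: "?D \<zeta> = 0" using gcp(3) by simp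
  note path = periodic_simple_path[of \<gamma>, OF curve_period curve_cont curve(1)]
  have im: "path_image \<gamma> \<subseteq> \<Omega>" "\<zeta> \<in> inside (path_image \<gamma>)"
    using curve_range curve(2) image by simp_all
  obtain w where w: "continuous_on {0..1} w" "\<forall>t\<in>{0..1}. ?D (\<gamma> t) = exp (w t)"
    "exp ((w 1 - w 0) / 2) = - 1"
    by (rule simple_zero_encircled_log[OF \<open>convex \<Omega>\<close> open_dom continuous_on_diff_squared[OF pair(1)]
        nz \<zeta>0 L path im])
  have sq: "(f t - g t)\<^sup>2 = ?D (\<gamma> t)" for t
    using fg[of t] by (auto simp: doubleton_eq_iff power2_commute)
  have "f 1 - g 1 = exp ((w 1 - w 0) / 2) * (f 0 - g 0)"
  proof (rule square_root_of_exp[of "\<lambda>t. f t - g t" w])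
    show "continuous_on {0..1} (\<lambda>t. f t - g t)"
      by (intro continuous_on_diff continuous_on_subset[OF f] continuous_on_subset[OF g]) auto
    show "\<forall>t\<in>{0..1}. (f t - g t)\<^sup>2 = exp (w t)" using w(2) sq by simp
  qed (rule w(1))
  then have flip: "f 1 - g 1 = - (f 0 - g 0)" using w(3) by simp
  have "\<gamma> 0 \<noteq> \<zeta>" using curve(2) inside_no_overlap[of "range \<gamma>"] by blast
  then have "f 0 \<noteq> g 0" using simple[OF curve_in_dom[of 0]] fg[of 0] by (auto simp: doubleton_eq_iff)
  then have "- (f 0 - g 0) \<noteq> f 0 - g 0"
    unfolding neg_equal_zero by simp
  then have "f 1 - g 1 \<noteq> f 0 - g 0" unfolding flip .
  moreover have "{f 1, g 1} = {f 0, g 0}" using fg[of 1] fg[of 0] curve_period[of 0] by simp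
  ultimately show "f 1 = g 0" "g 1 = f 0" by (auto simp: doubleton_eq_iff)
qed

end

section \<open>Frames with real parallel transport\<close>

lemma mult_mat_entry:
  assumes "M \<in> carrier_mat n m" "N \<in> carrier_mat m l" "i < n" "j < l"
  shows "(M * N) $$ (i,j) = (\<Sum>r<m. M $$ (i,r) * N $$ (r,j))"
  using assms by (simp add: scalar_prod_def lessThan_atLeast0)

lemma mult_monomial_mat_entry:
  fixes X :: "'a::semiring_0 mat"
  assumes "X \<in> carrier_mat n n" "i < n" "l < n" "\<sigma> l < n"
  shows "(X * mat n n (\<lambda>(i,l). if i = \<sigma> l then e l else 0)) $$ (i,l) = X $$ (i, \<sigma> l) * e l"
proof -
  have "(X * mat n n (\<lambda>(i,l). if i = \<sigma> l then e l else 0)) $$ (i,l) =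
      (\<Sum>r<n. X $$ (i,r) * mat n n (\<lambda>(i,l). if i = \<sigma> l then e l else 0) $$ (r,l))"
    by (rule mult_mat_entry[OF assms(1) _ assms(2,3)]) simp
  also have "\<dots> = (\<Sum>r<n. if r = \<sigma> l then X $$ (i, \<sigma> l) * e l else 0)"
    using assms(3) by (intro sum.cong) auto
  also have "\<dots> = X $$ (i, \<sigma> l) * e l" using assms(4) by simp
  finally show ?thesis .
qed

lemma col_inner_sum:
  assumes "M \<in> carrier_mat n n" "j < n" "l < n"
  shows "col_inner M j l = (\<Sum>i<n. M $$ (i,l) * cnj (M $$ (i,j)))"
  using assms by (simp add: col_inner_def scalar_prod_def lessThan_atLeast0)

text \<open>Jacobi's formula at the identity, read off the Leibniz expansion. A permutation other
  than the identity moves at least two indices, so after one factor is differentiated an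
  off-diagonal entry of the identity matrix remains and kills the term.\<close>

lemma det_has_vector_derivative_at_one:
  fixes M :: "real \<Rightarrow> complex mat"
  assumes "\<And>s. M s \<in> carrier_mat n n" "M t = 1\<^sub>m n"
    and deriv: "\<And>i j. \<lbrakk>i < n; j < n\<rbrakk> \<Longrightarrow> ((\<lambda>s. M s $$ (i,j)) has_vector_derivative D i j) (at t)"
  shows "((\<lambda>s. det (M s)) has_vector_derivative (\<Sum>i<n. D i i)) (at t)"
proof -
  let ?P = "{p. p permutes {0..<n}}"
  have prod: "((\<lambda>s. \<Prod>i = 0..<n. M s $$ (i, p i)) has_vector_derivative (if p = id then \<Sum>i<n. D i i else 0)) (at t)"
    if p: "p permutes {0..<n}" for p
  proof -
    have pn: "p i < n" if "i < n" for i using permutes_in_image[OF p, of i] that by simp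
    have "((\<lambda>s. \<Prod>i = 0..<n. M s $$ (i, p i)) has_derivative
        (\<lambda>h. \<Sum>i = 0..<n. (h *\<^sub>R D i (p i)) * (\<Prod>j\<in>{0..<n} - {i}. M t $$ (j, p j)))) (at t)"
      using deriv pn by (intro has_derivative_prod) (auto simp: has_vector_derivative_def)
    moreover have "(\<Sum>i = 0..<n. (h *\<^sub>R D i (p i)) * (\<Prod>j\<in>{0..<n} - {i}. M t $$ (j, p j))) =
        h *\<^sub>R (if p = id then \<Sum>i<n. D i i else 0)" for h
    proof (cases "p = id")
      case True
      then show ?thesis
        by (simp add: assms(2) lessThan_atLeast0 scaleR_sum_right)
    next
      case False
      have "(\<Prod>j\<in>{0..<n} - {i}. M t $$ (j, p j)) = 0" if i: "i < n" for i
      proof -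
        have "\<exists>j\<in>{0..<n} - {i}. p j \<noteq> j"
        proof (rule ccontr)
          assume "\<not> ?thesis"
          then have fix': "p j = j" if "j \<noteq> i" for j
            using that permutes_not_in[OF p] by (cases "j < n") auto
          have "p i = i"
            using fix'[of "p i"] permutes_inj[OF p] by (metis injD)
          then have "p x = id x" for x by (cases "x = i") (simp_all add: fix')
          then have "p = id" by (rule ext)
          with False show False by simp
        qed
        then obtain j where "j \<in> {0..<n} - {i}" "p j \<noteq> j" by blast
        then show ?thesis
          using pn[of j] assms(2) by (intro prod_zero bexI[of _ j]) auto
      qed
      then show ?thesis using False by (simp del: prod_zero_iff)
    qed
    ultimately show ?thesis by (simp add: has_vector_derivative_def)
  qed
  have "((\<lambda>s. \<Sum>p\<in>?P. signof p * (\<Prod>i = 0..<n. M s $$ (i, p i))) has_vector_derivative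
      (\<Sum>p\<in>?P. signof p * (if p = id then \<Sum>i<n. D i i else 0))) (at t)"
    using prod by (intro has_vector_derivative_sum has_vector_derivative_mult_right) auto
  moreover have "(\<Sum>p\<in>?P. signof p * (if p = id then \<Sum>i<n. D i i else 0)) = (\<Sum>i<n. D i i)"
    by (subst sum.remove[of _ id]) (auto simp: finite_permutations permutes_id)
  ultimately show ?thesis by (simp add: det_def'[OF assms(1)])
qed

text \<open>This isolates what parallel transport contributes: a linear equation with coefficient
  matrix \<open>Q\<close>, a real diagonal of \<open>Q\<close> and columns of constant norm. With
  \<open>Q\<close> as a parameter, a frame with reordered columns is again an instance, with
  \<open>Q\<close> reordered accordingly.\<close>

locale real_transport_frame =
  fixes n :: nat and W Q :: "real \<Rightarrow> complex mat"
  assumes W_carrier: "\<And>t. W t \<in> carrier_mat n n" and Q_carrier: "\<And>t. Q t \<in> carrier_mat n n"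
    and W_invertible: "\<And>t. invertible_mat (W t)"
    and W_deriv: "\<And>t i j. \<lbrakk>i < n; j < n\<rbrakk> \<Longrightarrow>
      ((\<lambda>s. W s $$ (i,j)) has_vector_derivative (W t * Q t) $$ (i,j)) (at t)"
    and Q_real: "\<And>t j. j < n \<Longrightarrow> Im (Q t $$ (j,j)) = 0"
    and norm_const: "\<And>t j. j < n \<Longrightarrow> col_inner (W t) j j = col_inner (W 0) j j"
begin

lemma minv_W: "minv (W t) \<in> carrier_mat n n" "W t * minv (W t) = 1\<^sub>m n" "minv (W t) * W t = 1\<^sub>m n"
  by (rule minv_inverts[OF W_carrier W_invertible])+

lemma minv_W_cancel: "X \<in> carrier_mat n m \<Longrightarrow> minv (W t) * (W t * X) = X"
  by (subst assoc_mult_mat[OF minv_W(1) W_carrier, symmetric]) (simp_all add: minv_W(3))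

text \<open>Premultiplication by the fixed matrix \<open>minv (W t)\<close> makes the frame pass
  through the identity at time \<open>t\<close>, where the derivative of the determinant is the
  trace of \<open>Q t\<close>. Multiplicativity undoes the normalization.\<close>

lemma det_has_vector_derivative:
  "((\<lambda>s. det (W s)) has_vector_derivative (\<Sum>i<n. Re (Q t $$ (i,i))) *\<^sub>R det (W t)) (at t)"
proof -
  let ?M = "\<lambda>s. minv (W t) * W s"
  have "((\<lambda>s. det (?M s)) has_vector_derivative (\<Sum>i<n. (minv (W t) * (W t * Q t)) $$ (i,i))) (at t)"
  proof (rule det_has_vector_derivative_at_one[where D = "\<lambda>i j. (minv (W t) * (W t * Q t)) $$ (i,j)"])
    fix i j assume ij: "i < n" "j < n"
    have WQ: "W t * Q t \<in> carrier_mat n n" using W_carrier Q_carrier by (rule mult_carrier_mat)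
    have "((\<lambda>s. \<Sum>r<n. minv (W t) $$ (i,r) * W s $$ (r,j)) has_vector_derivative
        (\<Sum>r<n. minv (W t) $$ (i,r) * (W t * Q t) $$ (r,j))) (at t)"
      using W_deriv ij by (intro has_vector_derivative_sum has_vector_derivative_mult_right) auto
    then show "((\<lambda>s. ?M s $$ (i,j)) has_vector_derivative (minv (W t) * (W t * Q t)) $$ (i,j)) (at t)"
      by (simp only: mult_mat_entry[OF minv_W(1) W_carrier ij] mult_mat_entry[OF minv_W(1) WQ ij])
  qed (simp_all add: minv_W mult_carrier_mat[OF minv_W(1) W_carrier])
  moreover have "minv (W t) * (W t * Q t) = Q t"
    by (rule minv_W_cancel[OF Q_carrier])
  moreover have "(\<Sum>i<n. Q t $$ (i,i)) = of_real (\<Sum>i<n. Re (Q t $$ (i,i)))"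
    using Q_real by (simp add: complex_eq_iff)
  ultimately have "((\<lambda>s. det (?M s)) has_vector_derivative of_real (\<Sum>i<n. Re (Q t $$ (i,i)))) (at t)"
    by simp
  then have "((\<lambda>s. det (W t) * det (?M s)) has_vector_derivative
      det (W t) * of_real (\<Sum>i<n. Re (Q t $$ (i,i)))) (at t)"
    by (rule has_vector_derivative_mult_right)
  moreover have "det (W t) * det (?M s) = det (W s)" for s
  proof -
    have "det (W t) * det (minv (W t)) = 1"
      using det_mult[OF W_carrier minv_W(1), of t t] minv_W(2)[of t] by simp
    then show ?thesis by (simp add: det_mult[OF minv_W(1) W_carrier] flip: mult.assoc)
  qed
  ultimately show ?thesis by (simp add: scaleR_conv_of_real mult.commute)
qed

lemma det_W_nonzero: "det (W t) \<noteq> 0"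
  using det_mult[OF W_carrier minv_W(1), of t t] minv_W(2)[of t] by auto

text \<open>The logarithmic derivative of the determinant is the trace of \<open>Q\<close>, which is real, so the
  argument of the determinant does not change.\<close>

lemma det_ratio_positive: "\<exists>r>0. det (W t) = of_real r * det (W 0)"
proof -
  define F where "F = (\<lambda>s. det (W s) / det (W 0))"
  define \<rho> where "\<rho> = (\<lambda>s. \<Sum>i<n. Re (Q s $$ (i,i)))"
  have dF: "(F has_vector_derivative \<rho> s *\<^sub>R F s) (at s)" for s
    unfolding F_def \<rho>_def
    using has_vector_derivative_divide[OF det_has_vector_derivative[of s], of "det (W 0)"] by (simp add: scaleR_conv_of_real)
  have F0: "F 0 = 1" and Fnz: "F s \<noteq> 0" for s
    using det_W_nonzero by (simp_all add: F_def)
  define u where "u = (\<lambda>s. Re (F s))"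
  define h where "h = (\<lambda>s. Im (F s))"
  have du: "(u has_real_derivative \<rho> s * u s) (at s)"
    and dh: "(h has_real_derivative \<rho> s * h s) (at s)" for s
    using dF[of s] by (auto simp: has_vector_derivative_complex_iff u_def h_def)
  \<comment> \<open>This is the squared sine of the argument of \<open>F\<close>. Real and imaginary
    part solve the same equation \<open>y' = \<rho> y\<close>, so it is constant; unlike the
    quotient of the two parts, it is defined before the real part is known to have no zeros.\<close>
  define G where "G = (\<lambda>s. (h s)\<^sup>2 / ((u s)\<^sup>2 + (h s)\<^sup>2))"
  have pos: "(u s)\<^sup>2 + (h s)\<^sup>2 \<noteq> 0" for s
    using Fnz[of s] by (simp add: u_def h_def sum_power2_eq_zero_iff complex_eq_iff)
  have "(G has_real_derivative 0) (at s)" for s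
  proof -
    have "(G has_real_derivative (2 * h s * (\<rho> s * h s) * ((u s)\<^sup>2 + (h s)\<^sup>2) -
        (h s)\<^sup>2 * (2 * u s * (\<rho> s * u s) + 2 * h s * (\<rho> s * h s))) /
        (((u s)\<^sup>2 + (h s)\<^sup>2) * ((u s)\<^sup>2 + (h s)\<^sup>2))) (at s)"
      unfolding G_def by (rule derivative_eq_intros du dh refl pos | simp)+
    then show ?thesis by (simp add: power2_eq_square algebra_simps)
  qed
  then have "G s = G 0" for s using DERIV_isconst_all by blast
  then have "(h s)\<^sup>2 / ((u s)\<^sup>2 + (h s)\<^sup>2) = 0" for s by (simp add: G_def h_def F0)
  then have "(h s)\<^sup>2 = 0" for s using pos[of s] unfolding divide_eq_0_iff by blast
  then have Im0: "Im (F s) = 0" for s by (simp add: h_def)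
  then have Re_nz: "Re (F s) \<noteq> 0" for s using Fnz[of s] by (auto simp: complex_eq_iff)
  have cont: "continuous_on UNIV (\<lambda>s. Re (F s))"
    using du unfolding u_def by (rule DERIV_continuous_on)
  have "Re (F t) > 0"
  proof (rule ccontr)
    assume "\<not> 0 < Re (F t)"
    have "connected (range (\<lambda>s. Re (F s)))"
      by (rule connected_continuous_image[OF cont connected_UNIV])
    from connectedD_interval[OF this rangeI rangeI, of t 0 0]
    have "0 \<in> range (\<lambda>s. Re (F s))"
      using \<open>\<not> 0 < Re (F t)\<close> F0 by simp
    then show False using Re_nz by force
  qed
  moreover have "det (W t) = of_real (Re (F t)) * det (W 0)"
  proof -
    have "of_real (Re (F t)) = F t" using Im0[of t] by (simp add: complex_eq_iff)
    then show ?thesis using det_W_nonzero[of 0] by (simp add: F_def)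
  qed
  ultimately show ?thesis by blast
qed

lemma col_inner_W_nonzero:
  assumes "j < n"
  shows "col_inner (W t) j j \<noteq> 0"
proof
  assume "col_inner (W t) j j = 0"
  then have "of_real (\<Sum>i<n. (norm (W t $$ (i,j)))\<^sup>2) = (0::complex)"
    using assms by (simp add: col_inner_sum[OF W_carrier] complex_norm_square del: of_real_power)
  then have "(\<Sum>i<n. (norm (W t $$ (i,j)))\<^sup>2) = 0" by (simp only: of_real_eq_0_iff)
  then have "W t $$ (i,j) = 0" if "i < n" for i
    using that by (subst (asm) sum_nonneg_eq_0_iff) auto
  then have "(minv (W t) * W t) $$ (j,j) = 0"
    using assms by (simp add: mult_mat_entry[OF minv_W(1) W_carrier])
  then show False using assms by (simp add: minv_W(3))
qed

text \<open>The multipliers are constant: their logarithmic derivative is the difference of two diagonal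
  entries of \<open>Q\<close>, hence real, while their modulus is 1.\<close>

lemma multipliers_constant:
  assumes \<sigma>: "\<sigma> permutes {..<n}"
    and matching: "\<And>j. j < n \<Longrightarrow> col_inner (W 0) j j = col_inner (W 0) (\<sigma> j) (\<sigma> j)"
    and shift: "\<And>t i j. \<lbrakk>i < n; j < n\<rbrakk> \<Longrightarrow> W (t + 1) $$ (i,j) = c t j * W t $$ (i, \<sigma> j)"
    and j: "j < n"
  shows "norm (c t j) = 1" "c t j = c 0 j"
proof -
  have \<sigma>n: "\<sigma> l < n" if "l < n" for l using permutes_in_image[OF \<sigma>, of l] that by simp
  have norm1: "norm (c s l) = 1" if l: "l < n" for s l
  proof -
    have "col_inner (W (s + 1)) l l = (c s l * cnj (c s l)) * col_inner (W s) (\<sigma> l) (\<sigma> l)"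
      using l \<sigma>n[OF l] by (simp add: col_inner_sum[OF W_carrier] shift sum_distrib_left mult_ac)
    moreover have "col_inner (W (s + 1)) l l = col_inner (W s) (\<sigma> l) (\<sigma> l)"
      using norm_const[OF l, of "s + 1"] norm_const[OF \<sigma>n[OF l], of s] matching[OF l] by simp
    ultimately have "c s l * cnj (c s l) = 1"
      using col_inner_W_nonzero[OF \<sigma>n[OF l], of s] by simp
    then have "complex_of_real ((norm (c s l))\<^sup>2) = of_real 1"
      by (simp only: complex_norm_square of_real_1)
    then have "(norm (c s l))\<^sup>2 = 1" by (simp only: of_real_eq_iff)
    then show ?thesis by (intro power2_eq_imp_eq[of _ 1]) simp_all
  qed
  then show "norm (c t j) = 1" using j by blast
  have W_deriv_shift: "((\<lambda>s. W (s + 1) $$ (i,l)) has_vector_derivative (W (s + 1) * Q (s + 1)) $$ (i,l)) (at s)"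
    if "i < n" "l < n" for i l s
  proof -
    have "((\<lambda>s. s + 1) has_vector_derivative 1) (at s)"
      by (auto intro!: derivative_eq_intros)
    from vector_diff_chain_at[OF this W_deriv[OF that]] show ?thesis by (simp add: o_def)
  qed
  \<comment> \<open>Differentiability of \<open>c\<close> comes from that of the frame:
    \<open>c\<close> is the inner product of the shifted column with its counterpart, divided by the
    constant squared norm \<open>K\<close>.\<close>
  have c_deriv: "\<exists>d. ((\<lambda>s. c s l) has_vector_derivative d) (at s)" if l: "l < n" for s l
  proof -
    define K where "K = col_inner (W 0) (\<sigma> l) (\<sigma> l)"
    have "K \<noteq> 0" using col_inner_W_nonzero[OF \<sigma>n[OF l]] by (simp add: K_def)
    have c_eq: "c u l = (\<Sum>i<n. W (u + 1) $$ (i,l) * cnj (W u $$ (i, \<sigma> l))) / K" for u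
    proof -
      have "(\<Sum>i<n. W (u + 1) $$ (i,l) * cnj (W u $$ (i, \<sigma> l))) = c u l * col_inner (W u) (\<sigma> l) (\<sigma> l)"
        using l \<sigma>n[OF l] by (simp add: col_inner_sum[OF W_carrier] shift sum_distrib_left mult_ac)
      also have "col_inner (W u) (\<sigma> l) (\<sigma> l) = K"
        using norm_const[OF \<sigma>n[OF l]] by (simp add: K_def)
      finally show ?thesis using \<open>K \<noteq> 0\<close> by simp
    qed
    have "((\<lambda>u. (\<Sum>i<n. W (u + 1) $$ (i,l) * cnj (W u $$ (i, \<sigma> l))) / K) has_vector_derivative
       (\<Sum>i<n. W (s + 1) $$ (i,l) * cnj ((W s * Q s) $$ (i, \<sigma> l)) +
          (W (s + 1) * Q (s + 1)) $$ (i,l) * cnj (W s $$ (i, \<sigma> l))) / K) (at s)"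
      using l \<sigma>n[OF l] W_deriv W_deriv_shift
      by (intro has_vector_derivative_divide has_vector_derivative_sum has_vector_derivative_mult
          has_vector_derivative_cnj) auto
    then show ?thesis unfolding c_eq[symmetric] by blast
  qed
  define d where "d = (\<lambda>s l. vector_derivative (\<lambda>u. c u l) (at s))"
  have d: "((\<lambda>u. c u l) has_vector_derivative d s l) (at s)" if l: "l < n" for s l
  proof -
    obtain d' where "((\<lambda>u. c u l) has_vector_derivative d') (at s)"
      using c_deriv[OF l] by blast
    then show ?thesis using vector_derivative_at[of "\<lambda>u. c u l" d' s] by (simp add: d_def)
  qed
  have "((\<lambda>u. c u j) has_vector_derivative 0) (at s)" for s
  proof -
    define N where "N = mat n n (\<lambda>(i,l). if i = \<sigma> l then c s l else 0)"
    define dN where "dN = mat n n (\<lambda>(i,l). if i = \<sigma> l then d s l else 0)"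
    have carr: "N \<in> carrier_mat n n" "dN \<in> carrier_mat n n" by (simp_all add: N_def dN_def)
    note Wc = W_carrier[of s] and Qc = Q_carrier[of s] and Q1c = Q_carrier[of "s + 1"]
    have monomial: "(X * N) $$ (i,l) = X $$ (i, \<sigma> l) * c s l" "(X * dN) $$ (i,l) = X $$ (i, \<sigma> l) * d s l"
      if "X \<in> carrier_mat n n" "i < n" "l < n" for X i l
      unfolding N_def dN_def
      by (rule mult_monomial_mat_entry[where \<sigma> = \<sigma>, OF that \<sigma>n[OF that(3)], of "c s"],
          rule mult_monomial_mat_entry[where \<sigma> = \<sigma>, OF that \<sigma>n[OF that(3)], of "d s"])
    have W1: "W (s + 1) = W s * N"
    proof (rule eq_matI)
      fix i l assume "i < dim_row (W s * N)" "l < dim_col (W s * N)"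
      then have il: "i < n" "l < n" using Wc carr by auto
      show "W (s + 1) $$ (i,l) = (W s * N) $$ (i,l)"
        unfolding monomial(1)[OF Wc il] shift[OF il] by simp
    qed (use W_carrier[of "s + 1"] Wc carr in auto)
    \<comment> \<open>The derivative of \<open>W (s + 1) = W s * N\<close> is computed twice: from
      the equation at time \<open>s + 1\<close>, and by the product rule at time \<open>s\<close>.
      Cancelling \<open>W s\<close> leaves a relation between the two coefficient matrices.\<close>
    have "W s * (N * Q (s + 1)) = W s * (dN + Q s * N)"
    proof (rule eq_matI)
      fix i l assume "i < dim_row (W s * (dN + Q s * N))" "l < dim_col (W s * (dN + Q s * N))"
      then have il: "i < n" "l < n" using Wc carr by auto
      have WQ: "W s * Q s \<in> carrier_mat n n" using Wc Qc by simp
      have "((\<lambda>u. W (u + 1) $$ (i,l)) has_vector_derivative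
          c s l * (W s * Q s) $$ (i, \<sigma> l) + d s l * W s $$ (i, \<sigma> l)) (at s)"
        unfolding shift[OF il]
        by (intro has_vector_derivative_mult d W_deriv il \<sigma>n)
      with W_deriv_shift[OF il] have "(W (s + 1) * Q (s + 1)) $$ (i,l) =
          c s l * (W s * Q s) $$ (i, \<sigma> l) + d s l * W s $$ (i, \<sigma> l)"
        by (rule vector_derivative_unique_at)
      also have "\<dots> = (W s * dN) $$ (i,l) + (W s * Q s * N) $$ (i,l)"
        unfolding monomial(1)[OF WQ il] monomial(2)[OF Wc il] by simp
      also have "\<dots> = (W s * dN + W s * Q s * N) $$ (i,l)" using il Wc carr by simp
      also have "W s * dN + W s * Q s * N = W s * (dN + Q s * N)"
        using Wc carr Qc by (simp add: mult_add_distrib_mat[of _ n n _ n] assoc_mult_mat[of _ n n _ n _ n])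
      also have "W (s + 1) * Q (s + 1) = W s * (N * Q (s + 1))"
        unfolding W1 using Wc carr Q1c by (simp add: assoc_mult_mat[of _ n n _ n _ n])
      finally show "(W s * (N * Q (s + 1))) $$ (i,l) = (W s * (dN + Q s * N)) $$ (i,l)" .
    qed (use Wc carr Qc Q1c in auto)
    then have "minv (W s) * (W s * (N * Q (s + 1))) = minv (W s) * (W s * (dN + Q s * N))" by (simp only:)
    moreover have "N * Q (s + 1) \<in> carrier_mat n n" "dN + Q s * N \<in> carrier_mat n n"
      using carr Qc Q1c by auto
    ultimately have eq: "N * Q (s + 1) = dN + Q s * N" by (simp only: minv_W_cancel)
    \<comment> \<open>In this entry the monomial form of \<open>N\<close> pairs two diagonal entries
      of \<open>Q\<close>, so their real difference appears as the logarithmic derivative of the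
      multiplier.\<close>
    have "(N * Q (s + 1)) $$ (\<sigma> j, j) = (\<Sum>r<n. (if \<sigma> j = \<sigma> r then c s r else 0) * Q (s + 1) $$ (r,j))"
      unfolding mult_mat_entry[OF carr(1) Q1c \<sigma>n[OF j] j]
      by (intro sum.cong refl) (simp add: N_def \<sigma>n[OF j])
    also have "\<dots> = (\<Sum>r<n. if r = j then c s j * Q (s + 1) $$ (j,j) else 0)"
      by (intro sum.cong refl) (auto simp: inj_eq[OF permutes_inj[OF \<sigma>]])
    also have "\<dots> = c s j * Q (s + 1) $$ (j,j)" using j by simp
    finally have "c s j * Q (s + 1) $$ (j,j) = d s j + Q s $$ (\<sigma> j, \<sigma> j) * c s j"
      using arg_cong[OF eq, of "\<lambda>X. X $$ (\<sigma> j, j)"] j \<sigma>n[OF j] carr Qc monomial(1)[OF Qc \<sigma>n[OF j] j]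
      by (simp add: dN_def)
    then have d_eq: "d s j = (Q (s + 1) $$ (j,j) - Q s $$ (\<sigma> j, \<sigma> j)) * c s j"
      by (simp add: algebra_simps)
    define \<rho> where "\<rho> = Re (Q (s + 1) $$ (j,j) - Q s $$ (\<sigma> j, \<sigma> j))"
    have "Q (s + 1) $$ (j,j) - Q s $$ (\<sigma> j, \<sigma> j) = of_real \<rho>"
      using Q_real[OF j] Q_real[OF \<sigma>n[OF j]] by (simp add: \<rho>_def complex_eq_iff)
    then have d_eq': "d s j = \<rho> *\<^sub>R c s j" using d_eq by (simp add: scaleR_conv_of_real)
    \<comment> \<open>Differentiating the constant squared modulus gives twice the real number
      \<rho>, which therefore vanishes.\<close>
    have "((\<lambda>u. c u j * cnj (c u j)) has_vector_derivative c s j * cnj (d s j) + d s j * cnj (c s j)) (at s)"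
      by (intro has_vector_derivative_mult has_vector_derivative_cnj d j)
    moreover have "c u j * cnj (c u j) = 1" for u
      using norm1[OF j, of u] by (simp flip: complex_norm_square)
    ultimately have "((\<lambda>u. 1) has_vector_derivative c s j * cnj (d s j) + d s j * cnj (c s j)) (at s)"
      by simp
    then have "c s j * cnj (d s j) + d s j * cnj (c s j) = 0"
      using has_vector_derivative_const by (rule vector_derivative_unique_at)
    moreover have "c s j * cnj (d s j) + d s j * cnj (c s j) = of_real (2 * \<rho>)"
      using \<open>\<And>u. c u j * cnj (c u j) = 1\<close>[of s]
      by (simp add: d_eq' scaleR_conv_of_real algebra_simps)
    ultimately have "complex_of_real (2 * \<rho>) = 0" by (simp only:)
    then have "\<rho> = 0" by simp
    then show ?thesis using d[OF j, of s] d_eq' by simp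
  qed
  then have "((\<lambda>u. c u j) has_derivative (\<lambda>h. 0)) (at s within UNIV)" for s
    by (simp add: has_vector_derivative_def)
  from has_derivative_zero_unique[OF convex_UNIV this, of t 0] show "c t j = c 0 j" by simp
qed

end

section \<open>Parallel-transport eigendecompositions\<close>

text \<open>Summed over all \<open>l\<close>, the terms
  \<open>col_inner (V t) j l * P $$ (l,j)\<close> give the inner product of the \<open>j\<close>-th
  column with its derivative. The real part of that is half the derivative of the squared norm, so
  the first transport condition makes the norm constant.\<close>

lemma transport_frame_of_eigendecomposition:
  assumes "Ck_eigendecomposition n k B V mu" "parallel_transport n V" "1 \<le> k"
  shows "real_transport_frame n V (\<lambda>t. minv (V t) * mat_derivative n V t)"
proof -
  let ?Q = "\<lambda>t. minv (V t) * mat_derivative n V t"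
  have Vc: "V t \<in> carrier_mat n n" and inv: "invertible_mat (V t)" for t
    using assms(1) by (auto simp: Ck_eigendecomposition_def Ck_mat_def)
  note Vi = minv_inverts[OF Vc inv]
  have Dc: "mat_derivative n V t \<in> carrier_mat n n" for t by (simp add: mat_derivative_def)
  have Qc: "?Q t \<in> carrier_mat n n" for t using Vi(1) Dc by (rule mult_carrier_mat)
  have VQ: "V t * ?Q t = mat_derivative n V t" for t
    by (subst assoc_mult_mat[OF Vc Vi(1) Dc, symmetric]) (simp only: Vi(2) left_mult_one_mat[OF Dc])
  have deriv: "((\<lambda>s. V s $$ (i,j)) has_vector_derivative (V t * ?Q t) $$ (i,j)) (at t)"
    if "i < n" "j < n" for i j t
  proof -
    obtain m where "k = Suc m" using assms(3) by (cases k) auto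
    moreover have "Ck k UNIV (\<lambda>s. V s $$ (i,j))"
      using assms(1) that by (auto simp: Ck_eigendecomposition_def Ck_mat_def)
    ultimately have "(\<lambda>s. V s $$ (i,j)) differentiable (at t)" by auto
    then show ?thesis
      unfolding VQ using that by (simp add: mat_derivative_def vector_derivative_works)
  qed
  have transport: "Re (\<Sum>l<n. col_inner (V t) j l * ?Q t $$ (l,j)) = 0" "Im (?Q t $$ (j,j)) = 0"
    if j: "j < n" for t j
  proof -
    have "Re (col_inner (V t) j j * ?Q t $$ (j,j)) =
        - (\<Sum>l\<in>{..<n} - {j}. Re (col_inner (V t) j l * ?Q t $$ (l,j)))"
      and Im0: "Im (?Q t $$ (j,j)) = 0"
      using assms(2) j unfolding parallel_transport_def Let_def by blast+
    then show "Re (\<Sum>l<n. col_inner (V t) j l * ?Q t $$ (l,j)) = 0"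
      using j by (simp add: sum.remove[of "{..<n}" j] del: times_complex.sel)
    show "Im (?Q t $$ (j,j)) = 0" by (rule Im0)
  qed
  have "col_inner (V t) j j = col_inner (V 0) j j" if j: "j < n" for t j
  proof -
    have "((\<lambda>s. col_inner (V s) j j) has_vector_derivative 0) (at s)" for s
    proof -
      let ?D = "V s * ?Q s"
      have "((\<lambda>s. \<Sum>i<n. V s $$ (i,j) * cnj (V s $$ (i,j))) has_vector_derivative
          (\<Sum>i<n. V s $$ (i,j) * cnj (?D $$ (i,j)) + ?D $$ (i,j) * cnj (V s $$ (i,j)))) (at s)"
        using deriv j
        by (intro has_vector_derivative_sum has_vector_derivative_mult has_vector_derivative_cnj) auto
      moreover have "(\<Sum>i<n. V s $$ (i,j) * cnj (?D $$ (i,j)) + ?D $$ (i,j) * cnj (V s $$ (i,j))) = 0"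
      proof -
        have "(\<Sum>i<n. ?D $$ (i,j) * cnj (V s $$ (i,j))) =
            (\<Sum>i<n. \<Sum>l<n. V s $$ (i,l) * cnj (V s $$ (i,j)) * ?Q s $$ (l,j))"
          using j by (intro sum.cong refl) (simp only: mult_mat_entry[OF Vc Qc] lessThan_iff sum_distrib_left sum_distrib_right mult_ac)
        also have "\<dots> = (\<Sum>l<n. col_inner (V s) j l * ?Q s $$ (l,j))"
          by (subst sum.swap, intro sum.cong refl) (simp only: col_inner_sum[OF Vc j] lessThan_iff sum_distrib_right)
        finally have "Re (\<Sum>i<n. ?D $$ (i,j) * cnj (V s $$ (i,j))) = 0"
          using transport(1)[OF j, of s] by simp
        moreover have "(\<Sum>i<n. V s $$ (i,j) * cnj (?D $$ (i,j)) + ?D $$ (i,j) * cnj (V s $$ (i,j))) =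
            of_real (2 * Re (\<Sum>i<n. ?D $$ (i,j) * cnj (V s $$ (i,j))))"
          by (subst complex_add_cnj[symmetric]) (simp add: sum.distrib mult.commute add.commute)
        ultimately show ?thesis by simp
      qed
      ultimately show ?thesis by (simp add: col_inner_sum[OF Vc j j])
    qed
    then have "((\<lambda>s. col_inner (V s) j j) has_derivative (\<lambda>h. 0)) (at s within UNIV)" for s
      by (simp add: has_vector_derivative_def)
    from has_derivative_zero_unique[OF convex_UNIV this, of t 0] show ?thesis by simp
  qed
  with Vc Qc inv deriv transport(2) show ?thesis by unfold_locales
qed

section \<open>Reordering the columns of a frame\<close>

lemma permute_cols_carrier: "permute_cols n p M \<in> carrier_mat n n"
  by (simp add: permute_cols_def)

text \<open>Reordering columns is multiplication by a constant permutation matrix, which conjugates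
  \<open>Q\<close>. Diagonal entries move to diagonal places and stay real, and the inverse has its
  rows reordered in the same way.\<close>

lemma (in real_transport_frame) permute_frame:
  assumes p: "p permutes {..<n}"
  shows "real_transport_frame n (\<lambda>t. permute_cols n p (W t)) (\<lambda>t. mat n n (\<lambda>(i,j). Q t $$ (p i, p j)))"
proof
  have pn: "p i < n" if "i < n" for i using permutes_in_image[OF p, of i] that by simp
  fix t
  let ?B = "mat n n (\<lambda>(i,j). minv (W t) $$ (p i, j))"
  have Bc: "?B \<in> carrier_mat n n" by simp
  have "permute_cols n p (W t) * ?B = 1\<^sub>m n"
  proof (rule eq_matI)
    fix i j assume "i < dim_row (1\<^sub>m n)" "j < dim_col (1\<^sub>m n)"
    then have ij: "i < n" "j < n" by auto
    have "(permute_cols n p (W t) * ?B) $$ (i,j) = (\<Sum>l<n. W t $$ (i, p l) * minv (W t) $$ (p l, j))"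
      unfolding mult_mat_entry[OF permute_cols_carrier Bc ij]
      using ij by (intro sum.cong refl) (simp add: permute_cols_def)
    also have "\<dots> = (\<Sum>l<n. W t $$ (i,l) * minv (W t) $$ (l,j))"
      using sum.permute[OF p, of "\<lambda>l. W t $$ (i,l) * minv (W t) $$ (l,j)"] by (simp add: o_def)
    also have "\<dots> = 1\<^sub>m n $$ (i,j)"
      unfolding mult_mat_entry[OF W_carrier minv_W(1) ij, symmetric] minv_W(2) ..
    finally show "(permute_cols n p (W t) * ?B) $$ (i,j) = 1\<^sub>m n $$ (i,j)" .
  qed (simp_all add: permute_cols_def)
  moreover have "?B * permute_cols n p (W t) = 1\<^sub>m n"
  proof (rule eq_matI)
    fix i j assume "i < dim_row (1\<^sub>m n)" "j < dim_col (1\<^sub>m n)"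
    then have ij: "i < n" "j < n" by auto
    have "(?B * permute_cols n p (W t)) $$ (i,j) = (\<Sum>l<n. minv (W t) $$ (p i, l) * W t $$ (l, p j))"
      unfolding mult_mat_entry[OF Bc permute_cols_carrier ij]
      using ij by (intro sum.cong refl) (simp add: permute_cols_def)
    also have "\<dots> = 1\<^sub>m n $$ (p i, p j)"
      unfolding mult_mat_entry[OF minv_W(1) W_carrier pn[OF ij(1)] pn[OF ij(2)], symmetric] minv_W(3) ..
    also have "\<dots> = 1\<^sub>m n $$ (i,j)"
      using ij pn inj_eq[OF permutes_inj[OF p]] by simp
    finally show "(?B * permute_cols n p (W t)) $$ (i,j) = 1\<^sub>m n $$ (i,j)" .
  qed (simp_all add: permute_cols_def)
  ultimately show "invertible_mat (permute_cols n p (W t))"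
    unfolding invertible_mat_def inverts_mat_def
    by (intro conjI exI[of _ ?B]) (simp_all add: permute_cols_def)
  have inner: "col_inner (permute_cols n p (W s)) j l = col_inner (W s) (p j) (p l)" if "j < n" "l < n" for s j l
    unfolding col_inner_sum[OF permute_cols_carrier that] col_inner_sum[OF W_carrier pn[OF that(1)] pn[OF that(2)]]
    using that by (intro sum.cong refl) (simp add: permute_cols_def)
  show "col_inner (permute_cols n p (W t)) j j = col_inner (permute_cols n p (W 0)) j j" if "j < n" for j
    using norm_const[OF pn[OF that]] by (simp add: inner that)
  show "Im (mat n n (\<lambda>(i,j). Q t $$ (p i, p j)) $$ (j,j)) = 0" if "j < n" for j
    using Q_real[OF pn[OF that]] that by simp
  fix i j assume ij: "i < n" "j < n"
  have Q'c: "mat n n (\<lambda>(i,j). Q t $$ (p i, p j)) \<in> carrier_mat n n" by simp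
  have "(permute_cols n p (W t) * mat n n (\<lambda>(i,j). Q t $$ (p i, p j))) $$ (i,j) =
      (\<Sum>l<n. W t $$ (i, p l) * Q t $$ (p l, p j))"
    unfolding mult_mat_entry[OF permute_cols_carrier Q'c ij]
    using ij by (intro sum.cong refl) (simp add: permute_cols_def)
  also have "\<dots> = (\<Sum>l<n. W t $$ (i,l) * Q t $$ (l, p j))"
    using sum.permute[OF p, of "\<lambda>l. W t $$ (i,l) * Q t $$ (l, p j)"] by (simp add: o_def)
  also have "\<dots> = (W t * Q t) $$ (i, p j)"
    by (rule mult_mat_entry[OF W_carrier Q_carrier ij(1) pn[OF ij(2)], symmetric])
  finally show "((\<lambda>s. permute_cols n p (W s) $$ (i,j)) has_vector_derivative
      (permute_cols n p (W t) * mat n n (\<lambda>(i,j). Q t $$ (p i, p j))) $$ (i,j)) (at t)"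
    using W_deriv[OF ij(1) pn[OF ij(2)], of t] ij by (simp add: permute_cols_def)
qed (simp_all add: permute_cols_def)

text \<open>Since \<open>B\<close> takes the same value at both times,
  \<open>M = minv (V t) * V (t + 1)\<close> intertwines the two diagonal matrices. Hence
  \<open>M $$ (s,l)\<close> is annihilated by the difference of \<open>mu t s\<close> and
  \<open>mu (t + 1) l\<close>, and in column \<open>l\<close> only row \<open>r\<close>
  survives.\<close>

lemma eigendecomposition_period_shift:
  assumes dec: "Ck_eigendecomposition n k B V mu" and per: "B (t + 1) = B t"
    and inj: "inj_on (mu t) {..<n}"
    and il: "i < n" "l < n" and r: "r < n" "mu (t + 1) l = mu t r"
  shows "V (t + 1) $$ (i,l) = (minv (V t) * V (t + 1)) $$ (r,l) * V t $$ (i,r)"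
proof -
  have Vc: "V s \<in> carrier_mat n n" and inv: "invertible_mat (V s)" for s
    using dec by (auto simp: Ck_eigendecomposition_def Ck_mat_def)
  have B_eq: "B s = V s * mat_diag n (mu s) * minv (V s)" for s
    using dec by (simp add: Ck_eigendecomposition_def)
  note Vi = minv_inverts[OF Vc inv]
  define M where "M = minv (V t) * V (t + 1)"
  have Mc: "M \<in> carrier_mat n n" unfolding M_def using Vi(1) Vc by (rule mult_carrier_mat)
  have Dc: "mat_diag n (mu s) \<in> carrier_mat n n" for s by simp
  have VM: "V (t + 1) = V t * M"
    unfolding M_def by (subst assoc_mult_mat[OF Vc Vi(1) Vc, symmetric]) (simp only: Vi(2) left_mult_one_mat[OF Vc])
  have BV: "B s * V s = V s * mat_diag n (mu s)" for s
    unfolding B_eq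
    by (subst assoc_mult_mat[OF mult_carrier_mat[OF Vc Dc] Vi(1) Vc])
      (simp only: Vi(3) right_mult_one_mat[OF mult_carrier_mat[OF Vc Dc]])
  have Bc: "B s \<in> carrier_mat n n" for s
    unfolding B_eq by (rule mult_carrier_mat[OF mult_carrier_mat[OF Vc Dc] Vi(1)])
  have "V t * (mat_diag n (mu t) * M) = V t * mat_diag n (mu t) * M"
    by (rule assoc_mult_mat[OF Vc Dc Mc, symmetric])
  also have "\<dots> = B t * V t * M" by (simp only: BV)
  also have "\<dots> = B (t + 1) * V (t + 1)" unfolding VM per by (rule assoc_mult_mat[OF Bc Vc Mc])
  also have "\<dots> = V (t + 1) * mat_diag n (mu (t + 1))" by (rule BV)
  also have "\<dots> = V t * M * mat_diag n (mu (t + 1))" unfolding VM ..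
  also have "\<dots> = V t * (M * mat_diag n (mu (t + 1)))" by (rule assoc_mult_mat[OF Vc Mc Dc])
  finally have eq: "V t * (mat_diag n (mu t) * M) = V t * (M * mat_diag n (mu (t + 1)))" .
  have cancel: "minv (V t) * (V t * X) = X" if "X \<in> carrier_mat n n" for X
    by (subst assoc_mult_mat[OF Vi(1) Vc that, symmetric]) (simp only: Vi(3) left_mult_one_mat[OF that])
  have eq': "mat_diag n (mu t) * M = M * mat_diag n (mu (t + 1))"
    using arg_cong[OF eq, of "\<lambda>X. minv (V t) * X"]
    by (simp only: cancel[OF mult_carrier_mat[OF Dc Mc]] cancel[OF mult_carrier_mat[OF Mc Dc]])
  have "M $$ (s,l) = 0" if s: "s < n" "s \<noteq> r" for s
  proof -
    have "mu t s * M $$ (s,l) = M $$ (s,l) * mu (t + 1) l"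
      using arg_cong[OF eq', of "\<lambda>X. X $$ (s,l)"] s il
      by (simp add: mat_diag_mult_left[OF Mc] mat_diag_mult_right[OF Mc])
    then have "(mu t s - mu t r) * M $$ (s,l) = 0" using r(2) by (simp add: algebra_simps)
    moreover have "mu t s \<noteq> mu t r" using inj_onD[OF inj, of s r] s r(1) by auto
    ultimately show ?thesis by simp
  qed
  then have "(\<Sum>s<n. V t $$ (i,s) * M $$ (s,l)) = (\<Sum>s<n. if s = r then V t $$ (i,r) * M $$ (r,l) else 0)"
    by (intro sum.cong) auto
  then have "V (t + 1) $$ (i,l) = V t $$ (i,r) * M $$ (r,l)"
    unfolding VM mult_mat_entry[OF Vc Mc il] using r(1) by simp
  then show ?thesis by (simp only: M_def mult.commute)
qed

lemma eigendecomposition_labelled: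
  assumes "Ck_eigendecomposition n k B V mu"
  shows "eigenvalues_labelled n (B t) (mu t)"
proof -
  have Vc: "V t \<in> carrier_mat n n" and inv: "invertible_mat (V t)"
    and B_eq: "B t = V t * mat_diag n (mu t) * minv (V t)"
    using assms by (auto simp: Ck_eigendecomposition_def Ck_mat_def)
  note Vi = minv_inverts[OF Vc inv]
  have Dc: "mat_diag n (mu t) \<in> carrier_mat n n" by simp
  have Bc: "B t \<in> carrier_mat n n"
    unfolding B_eq by (rule mult_carrier_mat[OF mult_carrier_mat[OF Vc Dc] Vi(1)])
  have "similar_mat (B t) (mat_diag n (mu t))"
    unfolding similar_mat_def
    using similar_mat_witI[OF Vi(2,3) B_eq Bc Dc Vc Vi(1)] by blast
  then have "char_poly (B t) = char_poly (mat_diag n (mu t))" by (rule char_poly_similar)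
  also have "\<dots> = (\<Prod>a\<leftarrow>diag_mat (mat_diag n (mu t)). [:- a, 1:])"
    by (rule char_poly_upper_triangular[OF Dc]) (auto simp: mat_diag_def)
  also have "diag_mat (mat_diag n (mu t)) = map (mu t) [0..<n]"
    by (auto simp: diag_mat_def mat_diag_def)
  also have "(\<Prod>a\<leftarrow>map (mu t) [0..<n]. [:- a, 1:]) = (\<Prod>j<n. [:- mu t j, 1:])"
    using prod.distinct_set_conv_list[of "[0..<n]" "\<lambda>j. [:- mu t j, 1:]"]
    by (simp add: o_def lessThan_atLeast0)
  finally show ?thesis by (simp add: eigenvalues_labelled_def)
qed

section \<open>The permutation of the eigenvalues and the block form of the monodromy\<close>

lemma inj_on_relabelling:
  assumes "inj_on f S" "inj_on g S" "f ` S = g ` S"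
  obtains p where "p permutes S" "\<forall>j\<in>S. f (p j) = g j"
proof -
  define p where "p = (\<lambda>j. if j \<in> S then inv_into S f (g j) else j)"
  have g: "g j \<in> f ` S" if "j \<in> S" for j using that assms(3) by blast
  have "bij_betw (\<lambda>j. inv_into S f (g j)) S S"
    using bij_betw_trans[OF inj_on_imp_bij_betw[OF assms(2)]] bij_betw_inv_into[OF inj_on_imp_bij_betw[OF assms(1)]]
    by (simp add: assms(3) o_def)
  then have "bij_betw p S S"
    by (rule bij_betw_cong[THEN iffD1, rotated]) (simp add: p_def)
  then have "p permutes S" by (rule bij_imp_permutes) (simp add: p_def)
  moreover have "\<forall>j\<in>S. f (p j) = g j" using f_inv_into_f[OF g] by (simp add: p_def)
  ultimately show thesis using that by blast
qed

text \<open>The permutation effected by one period: column \<open>j\<close> one period later is a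
  multiple of column \<open>pair_swaps j\<close>. It is its own inverse.\<close>

definition pair_swaps :: "nat \<Rightarrow> nat" where
  "pair_swaps j = (if j = 0 then 1 else if j = 1 then 0 else if j = 2 then 3 else if j = 3 then 2 else j)"

lemma pair_swaps_permutes:
  assumes "4 \<le> n"
  shows "pair_swaps permutes {..<n}"
proof (rule bij_imp_permutes)
  show "bij_betw pair_swaps {..<n} {..<n}"
    using assms by (intro bij_betw_byWitness[of _ pair_swaps]) (auto simp: pair_swaps_def)
qed (use assms in \<open>auto simp: pair_swaps_def\<close>)

lemma swap_block_carrier: "swap_block a b \<in> carrier_mat 2 2"
  by (intro carrier_matI) (simp_all add: swap_block_def mat_of_rows_list_def)

lemma swap_block_dim: "dim_row (swap_block a b) = 2" "dim_col (swap_block a b) = 2"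
  using swap_block_carrier[of a b] by simp_all

lemma swap_block_entry:
  assumes "i < 2" "j < 2"
  shows "swap_block a b $$ (i,j) = (if i = 0 \<and> j = 1 then cis b else if i = 1 \<and> j = 0 then cis a else 0)"
proof -
  have "i = 0 \<or> i = 1" "j = 0 \<or> j = 1" using assms by auto
  then show ?thesis by (auto simp: swap_block_def mat_of_rows_list_def)
qed

lemma swap_blocks_eq_four_block:
  "diag_block_mat [swap_block a b, swap_block c d, mat_diag m f] =
   four_block_mat (swap_block a b) (0\<^sub>m 2 (2 + m)) (0\<^sub>m (2 + m) 2)
     (four_block_mat (swap_block c d) (0\<^sub>m 2 m) (0\<^sub>m m 2) (mat_diag m f))"
proof -
  have "diag_block_mat [mat_diag m f] = mat_diag m f" by (rule diag_block_mat_singleton)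
  moreover have "dim_row (mat_diag m f) = m" "dim_col (mat_diag m f) = m" by (simp_all add: mat_diag_def)
  ultimately show ?thesis
    by (simp only: diag_block_mat.simps(2)[of _ "_ # _"] Let_def index_mat_four_block swap_block_dim)
qed

text \<open>The phase \<open>\<alpha> j\<close> belongs to column \<open>j\<close> and stands in row
  \<open>pair_swaps j\<close>. This is why the first argument of \<open>swap_block\<close> is in the
  lower left corner and why the phases of the diagonal block are shifted by 4.\<close>

lemma swap_blocks_eq_monomial:
  assumes "4 \<le> n"
  shows "diag_block_mat [swap_block (\<alpha> 0) (\<alpha> 1), swap_block (\<alpha> 2) (\<alpha> 3), mat_diag (n - 4) (\<lambda>j. cis (\<alpha> (j + 4)))] =
    mat n n (\<lambda>(i,j). if i = pair_swaps j then cis (\<alpha> j) else 0)"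
proof (rule eq_matI)
  fix i j
  assume "i < dim_row (mat n n (\<lambda>(i,j). if i = pair_swaps j then cis (\<alpha> j) else 0))"
    "j < dim_col (mat n n (\<lambda>(i,j). if i = pair_swaps j then cis (\<alpha> j) else 0))"
  then have ij: "i < n" "j < n" by auto
  have cases: "x = 0 \<or> x = 1 \<or> x = 2 \<or> x = 3 \<or> 4 \<le> x" for x :: nat by linarith
  show "diag_block_mat [swap_block (\<alpha> 0) (\<alpha> 1), swap_block (\<alpha> 2) (\<alpha> 3), mat_diag (n - 4) (\<lambda>j. cis (\<alpha> (j + 4)))] $$ (i,j) =
    mat n n (\<lambda>(i,j). if i = pair_swaps j then cis (\<alpha> j) else 0) $$ (i,j)"
    unfolding swap_blocks_eq_four_block
    using cases[of i] cases[of j] ij assms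
    by (elim disjE) (auto simp: swap_block_dim swap_block_entry mat_diag_def pair_swaps_def)
qed (use assms in \<open>auto simp: swap_blocks_eq_four_block swap_block_dim mat_diag_def\<close>)

lemma cis_sum: "cis (\<Sum>j\<in>S. f j) = (\<Prod>j\<in>S. cis (f j))"
  by (induction S rule: infinite_finite_induct) (simp_all add: cis_mult[symmetric])

text \<open>Each swap contributes a factor -1, and the two signs cancel.\<close>

lemma det_swap_blocks:
  assumes "4 \<le> n"
  shows "det (diag_block_mat [swap_block (\<alpha> 0) (\<alpha> 1), swap_block (\<alpha> 2) (\<alpha> 3), mat_diag (n - 4) (\<lambda>j. cis (\<alpha> (j + 4)))]) =
    cis (\<Sum>j<n. \<alpha> j)"
proof -
  obtain m where "n = m + 4" using assms by (metis le_add_diff_inverse2)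
  then have n: "n = Suc (Suc (Suc (Suc m)))" by simp
  have det2: "det (swap_block a b) = - (cis a * cis b)" for a b
    by (simp add: det_mat_2[OF swap_block_carrier] swap_block_entry)
  have Dc: "mat_diag m f \<in> carrier_mat m m" for f :: "nat \<Rightarrow> complex" by simp
  have detD: "det (mat_diag m f) = (\<Prod>j<m. f j)" for f :: "nat \<Rightarrow> complex"
  proof -
    have "det (mat_diag m f) = prod_list (diag_mat (mat_diag m f))"
      by (rule det_upper_triangular[OF _ Dc]) (auto simp: mat_diag_def)
    also have "diag_mat (mat_diag m f) = map f [0..<m]"
      by (auto simp: diag_mat_def mat_diag_def)
    also have "prod_list (map f [0..<m]) = (\<Prod>j<m. f j)"
      using prod.distinct_set_conv_list[of "[0..<m]" f] by (simp add: lessThan_atLeast0)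
    finally show ?thesis .
  qed
  let ?R = "four_block_mat (swap_block (\<alpha> 2) (\<alpha> 3)) (0\<^sub>m 2 m) (0\<^sub>m m 2) (mat_diag m (\<lambda>j. cis (\<alpha> (j + 4))))"
  have "?R \<in> carrier_mat (2 + m) (2 + m)" by (rule four_block_carrier_mat[OF swap_block_carrier Dc])
  then have "det (four_block_mat (swap_block (\<alpha> 0) (\<alpha> 1)) (0\<^sub>m 2 (2 + m)) (0\<^sub>m (2 + m) 2) ?R) =
      det (swap_block (\<alpha> 0) (\<alpha> 1)) * det ?R"
    by (rule det_four_block_mat_lower_left_zero[OF swap_block_carrier zero_carrier_mat refl])
  also have "det ?R = det (swap_block (\<alpha> 2) (\<alpha> 3)) * det (mat_diag m (\<lambda>j. cis (\<alpha> (j + 4))))"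
    by (rule det_four_block_mat_lower_left_zero[OF swap_block_carrier zero_carrier_mat refl Dc])
  also have "det (swap_block (\<alpha> 0) (\<alpha> 1)) * (det (swap_block (\<alpha> 2) (\<alpha> 3)) * det (mat_diag m (\<lambda>j. cis (\<alpha> (j + 4))))) =
      (\<Prod>j<n. cis (\<alpha> j))"
    unfolding n prod.lessThan_Suc_shift detD det2
    by (simp add: eval_nat_numeral mult_ac)
  finally show ?thesis
    unfolding swap_blocks_eq_four_block cis_sum using n by simp
qed

text \<open>The only multiple eigenvalue at \<zeta> is the common value of \<open>a\<close> and
  \<open>b\<close>. Any coinciding labels share it, and disjointness of the groups places them in
  \<open>G\<close>.\<close>

lemma (in spectral_groups) coalescing_labels_in_group:
  assumes "G \<in> \<G>" "gcp n k \<Omega> A \<zeta>" "1 \<le> k"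
    and "a \<in> G" "b \<in> G" "a \<noteq> b" "lam \<zeta> a = lam \<zeta> b"
    and ij: "i < n" "j < n" "i \<noteq> j" "lam \<zeta> i = lam \<zeta> j"
  shows "i \<in> G"
proof -
  have \<zeta>: "\<zeta> \<in> \<Omega>" using assms(2) by (simp add: gcp_def)
  have ab: "a < n" "b < n" using assms(1,4,5) Union_groups by auto
  have n: "2 \<le> n" using ab assms(6) by linarith
  have "lam \<zeta> i = lam \<zeta> a"
    by (rule gcp_multiple_eigenvalue_unique[OF assms(2,3) n carrier])
      (rule order_labelled_ge_2[OF labelled[OF \<zeta>] ij] order_labelled_ge_2[OF labelled[OF \<zeta>] ab assms(6,7)] | assumption)+
  moreover obtain H where "H \<in> \<G>" "i \<in> H" using ij(1) Union_groups by auto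
  moreover have "lam \<zeta> ` G \<inter> lam \<zeta> ` H = {}" if "H \<noteq> G"
    using groups[unfolded eigenvalue_groups_def, THEN conjunct1, rule_format, OF \<zeta> assms(1) \<open>H \<in> \<G>\<close>] that by simp
  ultimately show ?thesis using assms(4) by (cases "H = G") (auto dest: equalityD1)
qed

text \<open>The determinant of the monodromy matrix is the ratio of \<open>det (W 1)\<close> and
  \<open>det (W 0)\<close>, a positive real number; computed from the blocks it has modulus 1. Hence
  it is 1, which is the condition on the sum of the phases.\<close>

lemma (in real_transport_frame) monodromy_matrix:
  assumes n: "4 \<le> n"
    and matching: "\<And>j. j < n \<Longrightarrow> col_inner (W 0) j j = col_inner (W 0) (pair_swaps j) (pair_swaps j)"
    and shift: "\<And>t i j. \<lbrakk>i < n; j < n\<rbrakk> \<Longrightarrow> W (t + 1) $$ (i,j) = c t j * W t $$ (i, pair_swaps j)"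
  obtains \<alpha> where
    "\<forall>t. minv (W t) * W (t + 1) = diag_block_mat [swap_block (\<alpha> 0) (\<alpha> 1), swap_block (\<alpha> 2) (\<alpha> 3),
       mat_diag (n - 4) (\<lambda>j. cis (\<alpha> (j + 4)))]"
    "\<exists>m::int. (\<Sum>j<n. \<alpha> j) = 2 * pi * of_int m"
proof -
  \<comment> \<open>With principal arguments the sum of the phases need not be 0; it is an integer
    multiple of \<open>2 * pi\<close>.\<close>
  define \<alpha> where "\<alpha> = (\<lambda>j. Arg (c 0 j))"
  define N where "N = mat n n (\<lambda>(i,j). if i = pair_swaps j then cis (\<alpha> j) else 0)"
  note mult = multipliers_constant[OF pair_swaps_permutes[OF n] matching shift]
  have pn: "pair_swaps j < n" if "j < n" for j
    using permutes_in_image[OF pair_swaps_permutes[OF n], of j] that by simp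
  have c: "c t j = cis (\<alpha> j)" if "j < n" for t j
  proof -
    have "norm (c 0 j) = 1" using mult(1) that by blast
    then have "cis (\<alpha> j) = c 0 j"
      using cis_Arg[of "c 0 j"] by (force simp: \<alpha>_def sgn_div_norm)
    then show ?thesis using mult(2)[where t = t and j = j] that by simp
  qed
  have Nc: "N \<in> carrier_mat n n" by (simp add: N_def)
  have WN: "W (t + 1) = W t * N" for t
  proof (rule eq_matI)
    fix i j assume "i < dim_row (W t * N)" "j < dim_col (W t * N)"
    then have ij: "i < n" "j < n" using W_carrier[of t] Nc by auto
    show "W (t + 1) $$ (i,j) = (W t * N) $$ (i,j)"
      unfolding N_def
        mult_monomial_mat_entry[where \<sigma> = pair_swaps and e = "\<lambda>j. cis (\<alpha> j)", OF W_carrier ij pn[OF ij(2)]]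
        shift[OF ij] c[OF ij(2)] by simp
  qed (use W_carrier[of t] W_carrier[of "t + 1"] Nc in auto)
  have N_eq: "N = diag_block_mat [swap_block (\<alpha> 0) (\<alpha> 1), swap_block (\<alpha> 2) (\<alpha> 3),
      mat_diag (n - 4) (\<lambda>j. cis (\<alpha> (j + 4)))]"
    unfolding N_def by (rule swap_blocks_eq_monomial[OF n, symmetric])
  have "det (W 1) = det (W 0) * det N"
    using WN[of 0] det_mult[OF W_carrier[of 0] Nc] by simp
  moreover obtain r where r: "r > 0" "det (W 1) = of_real r * det (W 0)"
    using det_ratio_positive[of 1] by blast
  ultimately have "det N = of_real r" using det_W_nonzero[of 0] by simp
  then have cis_r: "cis (\<Sum>j<n. \<alpha> j) = of_real r"
    unfolding N_eq det_swap_blocks[OF n] .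
  have "norm (cis (\<Sum>j<n. \<alpha> j)) = 1" by (rule norm_cis)
  then have "r = 1" unfolding cis_r using r(1) by simp
  then have "cos (\<Sum>j<n. \<alpha> j) = 1" using arg_cong[OF cis_r, of Re] by simp
  then obtain m :: int where "(\<Sum>j<n. \<alpha> j) = of_int m * 2 * pi"
    using cos_one_2pi_int by blast
  then have "\<exists>m::int. (\<Sum>j<n. \<alpha> j) = 2 * pi * of_int m" by (intro exI[of _ m]) simp
  moreover have "minv (W t) * W (t + 1) = N" for t
    unfolding WN by (rule minv_W_cancel[OF Nc])
  ultimately show thesis using N_eq that by metis
qed

theorem theorem2p29:
  fixes n k :: nat
    and \<Omega> :: "(real^2) set"
    and A :: "real^2 \<Rightarrow> complex mat"
    and lam :: "real^2 \<Rightarrow> nat \<Rightarrow> complex"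
    and \<xi>\<^sub>0 \<xi>\<^sub>1 :: "real^2"
    and \<gamma> :: "real \<Rightarrow> real^2"
    and V :: "real \<Rightarrow> complex mat"
    and mu :: "real \<Rightarrow> nat \<Rightarrow> complex"
  assumes "1 \<le> k" and "5 \<le> n"
    and "open \<Omega>" and "convex \<Omega>"
    and "Ck_mat n k \<Omega> A"
    and "\<And>\<xi>. \<xi> \<in> \<Omega> \<Longrightarrow> eigenvalues_labelled n (A \<xi>) (lam \<xi>)"
    and "eigenvalue_groups \<Omega> lam {{0,1}, {2,3}, {4..<n}}"
    and "\<xi>\<^sub>0 \<noteq> \<xi>\<^sub>1"
    and "gcp n k \<Omega> A \<xi>\<^sub>0" and "lam \<xi>\<^sub>0 0 = lam \<xi>\<^sub>0 1"
    and "gcp n k \<Omega> A \<xi>\<^sub>1" and "lam \<xi>\<^sub>1 2 = lam \<xi>\<^sub>1 3"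
    and "\<And>\<xi>. \<xi> \<in> \<Omega> - {\<xi>\<^sub>0, \<xi>\<^sub>1} \<Longrightarrow> simple_eigenvalues (A \<xi>)"
    and "smooth_jordan_curve \<gamma>" and "range \<gamma> \<subseteq> \<Omega>"
    and "\<xi>\<^sub>0 \<in> inside (range \<gamma>)" and "\<xi>\<^sub>1 \<in> inside (range \<gamma>)"
    and "minimal_period 1 (\<lambda>t. A (\<gamma> t))"
    and "Ck_eigendecomposition n k (\<lambda>t. A (\<gamma> t)) V mu"
    and "parallel_transport n V"
    and "matching_norms n V mu"
  shows "\<exists>p \<alpha>. p permutes {..<n} \<and>
    (let mu' = (\<lambda>t j. mu t (p j)); V' = (\<lambda>t. permute_cols n p (V t)) in
      (\<forall>t. mu' t ` {0,1} = lam (\<gamma> t) ` {0,1} \<and>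
           mu' t ` {2,3} = lam (\<gamma> t) ` {2,3} \<and>
           mu' t ` {4..<n} = lam (\<gamma> t) ` {4..<n}) \<and>
      (\<forall>t. mu' (t + 1) 0 = mu' t 1 \<and> mu' (t + 1) 1 = mu' t 0) \<and>
      (\<forall>t. mu' (t + 1) 2 = mu' t 3 \<and> mu' (t + 1) 3 = mu' t 2) \<and>
      (\<forall>t. \<forall>j\<in>{4..<n}. mu' (t + 1) j = mu' t j) \<and>
      (\<forall>t. minv (V' t) * V' (t + 1) =
         diag_block_mat [swap_block (\<alpha> 0) (\<alpha> 1), swap_block (\<alpha> 2) (\<alpha> 3),
           mat_diag (n - 4) (\<lambda>j. cis (\<alpha> (j + 4)))])) \<and>
    (\<exists>m::int. (\<Sum>j<n. \<alpha> j) = 2 * pi * of_int m)"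
proof -
  let ?G = "{{0, 1}, {2, 3}, {4..<n}} :: nat set set"
  have n4: "4 \<le> n" using assms(2) by simp
  have carrier: "A \<xi> \<in> carrier_mat n n" if "\<xi> \<in> \<Omega>" for \<xi>
    using assms(5) that by (simp add: Ck_mat_def)
  have curve_cont: "continuous_on UNIV \<gamma>"
    using assms(14) unfolding smooth_jordan_curve_def by (intro Ck_imp_continuous_on) blast
  have curve_period: "\<gamma> (t + 1) = \<gamma> t" for t
    using assms(14) by (simp add: smooth_jordan_curve_def minimal_period_def)
  have curve_inj: "inj_on \<gamma> {0..<1}"
    using assms(14) by (simp add: smooth_jordan_curve_def)
  interpret spectral_groups_curve n \<Omega> A lam ?G \<gamma>
  proof
    show "continuous_on \<Omega> (\<lambda>\<xi>. A \<xi> $$ (i,j))" if "i < n" "j < n" for i j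
      using assms(5) that by (intro Ck_imp_continuous_on[of k]) (simp add: Ck_mat_def)
    show "\<Union>?G = {..<n}" using assms(2) by auto
  qed (use assms(3,6,7,15) carrier curve_cont curve_period in auto)
  have simple_off: "inj_on (lam \<xi>) {..<n}" if "\<xi> \<in> \<Omega>" "\<xi> \<noteq> \<xi>\<^sub>0" "\<xi> \<noteq> \<xi>\<^sub>1" for \<xi>
    using inj_on_labelled[OF labelled assms(13)] that by simp
  \<comment> \<open>At each cuspidal point the only coinciding labels are those of its own pair. So
    the last group is simple on all of \<Omega>, and each pair is simple away from its own cuspidal
    point.\<close>
  have coalesce0: "i \<in> {0, 1}" if "i < n" "j < n" "i \<noteq> j" "lam \<xi>\<^sub>0 i = lam \<xi>\<^sub>0 j" for i j
    by (rule coalescing_labels_in_group[OF _ assms(9,1) _ _ _ assms(10) that]) auto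
  have coalesce1: "i \<in> {2, 3}" if "i < n" "j < n" "i \<noteq> j" "lam \<xi>\<^sub>1 i = lam \<xi>\<^sub>1 j" for i j
    by (rule coalescing_labels_in_group[OF _ assms(11,1) _ _ _ assms(12) that]) auto
  have simple: "lam \<xi> i \<noteq> lam \<xi> j"
    if "\<xi> \<in> \<Omega>" "i < n" "j < n" "i \<noteq> j" "\<xi> = \<xi>\<^sub>0 \<longrightarrow> i \<notin> {0, 1}" "\<xi> = \<xi>\<^sub>1 \<longrightarrow> i \<notin> {2, 3}" for \<xi> i j
    using that simple_off[OF that(1)] coalesce0[OF that(2-4)] coalesce1[OF that(2-4)]
    by (cases "\<xi> = \<xi>\<^sub>0"; cases "\<xi> = \<xi>\<^sub>1") (auto dest: inj_onD)
  have simple4: "inj_on (lam \<xi>) {4..<n}" if "\<xi> \<in> \<Omega>" for \<xi>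
  proof (rule inj_onI, rule ccontr)
    fix i j assume "i \<in> {4..<n}" "j \<in> {4..<n}" "lam \<xi> i = lam \<xi> j" "i \<noteq> j"
    then show False using simple[OF that, of i j] by auto
  qed
  have simple01: "lam \<xi> 0 \<noteq> lam \<xi> 1" if "\<xi> \<in> \<Omega>" "\<xi> \<noteq> \<xi>\<^sub>0" for \<xi>
    using simple[OF that(1), of 0 1] that(2) n4 by simp
  have simple23: "lam \<xi> 2 \<noteq> lam \<xi> 3" if "\<xi> \<in> \<Omega>" "\<xi> \<noteq> \<xi>\<^sub>1" for \<xi>
    using simple[OF that(1), of 2 3] that(2) n4 by simp
  have off: "\<gamma> t \<noteq> \<xi>\<^sub>0" "\<gamma> t \<noteq> \<xi>\<^sub>1" for t
    using assms(16,17) inside_no_overlap[of "range \<gamma>"] by blast+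
  have inj_lam: "inj_on (lam (\<gamma> t)) {..<n}" for t
    by (rule simple_off[OF curve_in_dom off])
  have simple_curve: "simple_eigenvalues (A (\<gamma> t))" for t
    using assms(13) curve_in_dom off by simp
  have labelled_mu: "eigenvalues_labelled n (A (\<gamma> t)) (mu t)" for t
    by (rule eigendecomposition_labelled[OF assms(19)])
  have inj_mu: "inj_on (mu t) {..<n}" for t
    by (rule inj_on_labelled[OF labelled_mu simple_curve])
  have mu_image: "mu t ` {..<n} = lam (\<gamma> t) ` {..<n}" for t
    using labelled_root_iff[OF labelled_mu] labelled_root_iff[OF labelled[OF curve_in_dom]] by blast
  have mu_cont: "continuous_on UNIV (\<lambda>t. mu t j)" if "j < n" for j
    using assms(19) that by (intro Ck_imp_continuous_on[of k]) (simp add: Ck_eigendecomposition_def)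
  \<comment> \<open>The permutation is fixed once, by matching the two labellings at time 0. Later
    only the groups are compared, because \<open>lam\<close> may jump inside a group along the
    curve.\<close>
  obtain p where p: "p permutes {..<n}" "\<forall>j\<in>{..<n}. mu 0 (p j) = lam (\<gamma> 0) j"
    using inj_on_relabelling[OF inj_mu inj_lam mu_image] .
  have pn: "p j < n" if "j < n" for j using permutes_in_image[OF p(1), of j] that by simp
  define mu' where "mu' = (\<lambda>t j. mu t (p j))"
  define V' where "V' = (\<lambda>t. permute_cols n p (V t))"
  have cont': "continuous_on UNIV (\<lambda>t. mu' t j)" if "j < n" for j
    unfolding mu'_def by (rule mu_cont[OF pn[OF that]])
  have inj': "inj_on (mu' t) {..<n}" for t
    using comp_inj_on[OF permutes_inj_on[OF p(1)], of "mu t" "{..<n}"] inj_mu permutes_image[OF p(1)]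
    by (simp add: mu'_def o_def)
  have image': "mu' t ` {..<n} = lam (\<gamma> t) ` {..<n}" for t
  proof -
    have "mu' t ` {..<n} = mu t ` p ` {..<n}" by (simp add: mu'_def image_image)
    then show ?thesis by (simp only: permutes_image[OF p(1)] mu_image)
  qed
  have sub_labels: "G \<subseteq> {..<n}" if "G \<in> ?G" for G
    using Union_upper[OF that] by (simp only: Union_groups)
  have in_group: "mu' t j \<in> lam (\<gamma> t) ` G" if G: "G \<in> ?G" and jG: "j \<in> G" for t G j
  proof (rule eigenvalue_stays_in_group[where s = 0 and f = "\<lambda>t. mu' t j"])
    have j: "j < n" using sub_labels[OF G] jG by auto
    then show "continuous_on UNIV (\<lambda>t. mu' t j)" by (rule cont')
    show "mu' t j \<in> lam (\<gamma> t) ` {..<n}" for t using image'[of t] j by auto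
    show "mu' 0 j \<in> lam (\<gamma> 0) ` G" using p(2) j jG by (simp add: mu'_def)
  qed (rule G)
  \<comment> \<open>Inclusion becomes equality by counting, as both labellings are injective along
    the curve.\<close>
  have group_image: "mu' t ` G = lam (\<gamma> t) ` G" if "G \<in> ?G" for t G
  proof (rule card_subset_eq)
    have G: "G \<subseteq> {..<n}" by (rule sub_labels[OF that])
    then show "finite (lam (\<gamma> t) ` G)" by (simp add: finite_subset)
    show "mu' t ` G \<subseteq> lam (\<gamma> t) ` G" using in_group[OF that] by blast
    show "card (mu' t ` G) = card (lam (\<gamma> t) ` G)"
      using inj_on_subset[OF inj' G] inj_on_subset[OF inj_lam G] by (simp add: card_image)
  qed
  have images: "mu' t ` {0, 1} = lam (\<gamma> t) ` {0, 1}" "mu' t ` {2, 3} = lam (\<gamma> t) ` {2, 3}"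
    "mu' t ` {4..<n} = lam (\<gamma> t) ` {4..<n}" for t
    by (rule group_image, simp)+
  have swap01: "mu' 1 0 = mu' 0 1" "mu' 1 1 = mu' 0 0"
    using pair_swapped[OF _ _ assms(9,1,10,4) simple01 curve_inj assms(16) cont' cont', of 0 1] images(1) n4
    by simp_all
  have swap23: "mu' 1 2 = mu' 0 3" "mu' 1 3 = mu' 0 2"
    using pair_swapped[OF _ _ assms(11,1,12,4) simple23 curve_inj assms(17) cont' cont', of 2 3] images(2) n4
    by simp_all
  have fixed: "mu' (t + 1) j = mu' t j" if "j \<in> {4..<n}" for t j
    using that in_group[of "{4..<n}" j]
    by (intro eigenvalue_of_simple_group_periodic[of "{4..<n}"] simple4 assms(4) cont') auto
  have swaps_0: "mu' 1 j = mu' 0 (pair_swaps j)" if "j < n" for j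
    using swap01 swap23 fixed[of j 0] that by (auto simp: pair_swaps_def)
  have swaps_n: "pair_swaps j < n" if "j < n" for j
    using permutes_in_image[OF pair_swaps_permutes[OF n4], of j] that by simp
  \<comment> \<open>For the pairs the permutation is known so far only between the times 0 and 1. A
    label shifted by one period is continuous with values among the labels, so it follows the same
    label for all times.\<close>
  have swaps: "mu' (t + 1) j = mu' t (pair_swaps j)" if j: "j < n" for t j
  proof (rule continuous_label_constant[OF cont' inj', where s = 0])
    show "continuous_on UNIV (\<lambda>t. mu' (t + 1) j)"
      by (intro continuous_on_compose2[OF cont'[OF j]] continuous_intros) auto
    show "mu' (t + 1) j \<in> mu' t ` {..<n}" for t
    proof -
      have "mu' (t + 1) ` {..<n} = mu' t ` {..<n}" by (simp only: image' curve_period)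
      then show ?thesis using j by (metis imageI lessThan_iff)
    qed
  qed (use swaps_0[OF j] swaps_n[OF j] in auto)
  interpret frame: real_transport_frame n V "\<lambda>t. minv (V t) * mat_derivative n V t"
    by (rule transport_frame_of_eigendecomposition[OF assms(19,20,1)])
  interpret frame': real_transport_frame n V' "\<lambda>t. mat n n (\<lambda>(i,j). (minv (V t) * mat_derivative n V t) $$ (p i, p j))"
    unfolding V'_def by (rule frame.permute_frame[OF p(1)])
  have inner': "col_inner (V' 0) j j = col_inner (V 0) (p j) (p j)" if "j < n" for j
    unfolding col_inner_sum[OF frame'.W_carrier that that] col_inner_sum[OF frame.W_carrier pn[OF that] pn[OF that]]
    using that by (intro sum.cong refl) (simp add: V'_def permute_cols_def)
  define c where "c = (\<lambda>t j. (minv (V t) * V (t + 1)) $$ (p (pair_swaps j), p j))"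
  \<comment> \<open>\<open>matching_norms\<close> compares columns whose eigenvalues replace each
    other after one period; \<open>swaps_0\<close> identifies them.\<close>
  have matching: "col_inner (V' 0) j j = col_inner (V' 0) (pair_swaps j) (pair_swaps j)" if j: "j < n" for j
    using assms(21) pn[OF j] pn[OF swaps_n[OF j]] swaps_0[OF j]
    unfolding matching_norms_def inner'[OF j] inner'[OF swaps_n[OF j]] mu'_def by blast
  have shift: "V' (t + 1) $$ (i,j) = c t j * V' t $$ (i, pair_swaps j)" if ij: "i < n" "j < n" for t i j
  proof -
    have "V (t + 1) $$ (i, p j) = c t j * V t $$ (i, p (pair_swaps j))"
      unfolding c_def
      by (rule eigendecomposition_period_shift[OF assms(19) _ inj_mu ij(1) pn[OF ij(2)] pn[OF swaps_n[OF ij(2)]]])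
        (use swaps[OF ij(2)] in \<open>simp_all add: curve_period mu'_def\<close>)
    then show ?thesis using ij swaps_n[OF ij(2)] by (simp add: V'_def permute_cols_def)
  qed
  obtain \<alpha> where \<alpha>:
    "\<forall>t. minv (V' t) * V' (t + 1) = diag_block_mat [swap_block (\<alpha> 0) (\<alpha> 1), swap_block (\<alpha> 2) (\<alpha> 3),
       mat_diag (n - 4) (\<lambda>j. cis (\<alpha> (j + 4)))]"
    "\<exists>m::int. (\<Sum>j<n. \<alpha> j) = 2 * pi * of_int m"
    by (rule frame'.monodromy_matrix[OF n4 matching shift])
  have "mu' (t + 1) 0 = mu' t 1" "mu' (t + 1) 1 = mu' t 0" "mu' (t + 1) 2 = mu' t 3" "mu' (t + 1) 3 = mu' t 2" for t
    using swaps[of 0 t] swaps[of 1 t] swaps[of 2 t] swaps[of 3 t] n4 by (simp_all add: pair_swaps_def)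
  then show ?thesis
    using p(1) images fixed \<alpha>
    unfolding Let_def mu'_def[symmetric] V'_def[symmetric]
    by (intro exI[of _ p] exI[of _ \<alpha>]) (simp add: mu'_def V'_def)
qed

end
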